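(* Let $U$ be a $2$-dimensional vector space over $\mathbb C$ and let $n\ge 1$ be an integer. The decomposition of $\wedge^2S^nU$ into irreducible representations of $\mathrm{SL}(2)=\mathrm{SL}(U)$ is $$\wedge^2S^nU=S^{2(n-1)}U\oplus S^{2(n-3)}U\oplus S^{2(n-5)}U\oplus\cdots .$$ Moreover, if $W=S^{2(n-3)}U\oplus S^{2(n-5)}U\oplus\cdots\subseteq\wedge^2S^nU$, then $$\dim_{\mathbb C}\mathbb P(W)=m-1\quad\text{and}\quad\mathbb P(W)\cap\mathbb G(1,n)=\emptyset,\qquad\text{where } m=\frac{(n-2)(n-1)}{2};$$ in particular $W$ contains no nonzero decomposable bivector.
   Context: The sum runs over the terms $S^{2(n-1-2j)}U$ with $j\ge 0$ and $2(n-1-2j)\ge 0$. $W$ is the sum of all irreducible summands other than $S^{2(n-1)}U$. $\mathbb P(W)$ is the space of lines through the origin in $W$ (so $\dim\mathbb P(W)=\dim W-1$), and $\mathbb G(1,n)\subseteq\mathbb P(\wedge^2S^nU)$ is the Grassmannian of lines in $\mathbb P^n=\mathbb P(S^nU)$, i.e. the set of classes of nonzero decomposable bivectors $v\wedge v'$, with $v,v'\in S^nU$. *)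

theory Defs
  imports "HOL-Analysis.Determinants" "HOL-Library.Function_Algebras"
begin

(* A complex vector space is a type of class ab_group_add with a scalar multiplication s
   satisfying "vector_space s".  Spaces of complex-valued functions carry the pointwise
   operations; their scalar multiplication is fscale. *)

definition fscale :: "complex \<Rightarrow> ('x \<Rightarrow> complex) \<Rightarrow> 'x \<Rightarrow> complex" where
  "fscale c f = (\<lambda>x. c * f x)"

lemma vector_space_fscale: "vector_space fscale"
  by unfold_locales (auto simp: fscale_def fun_eq_iff algebra_simps)

definition dual :: "(complex \<Rightarrow> 'v::ab_group_add \<Rightarrow> 'v) \<Rightarrow> ('v \<Rightarrow> complex) set" where
  "dual s = {\<phi>. Vector_Spaces.linear s (*) \<phi>}"

(* Symmetric powers: Sym(U) is realised without a choice of basis as the algebra of polynomial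
   functions on the dual space U^*.  The product u_1 ... u_n is the function
   \<phi> |-> \<phi>(u_1) ... \<phi>(u_n) on U^*, and S^n U is the span of these products.  Since the ground
   field is infinite, this is the degree n part of the symmetric algebra.  Functions are set
   to 0 off U^*, so that they are determined by their values on U^*. *)

definition sym_prod :: "(complex \<Rightarrow> 'u::ab_group_add \<Rightarrow> 'u) \<Rightarrow> 'u list \<Rightarrow> ('u \<Rightarrow> complex) \<Rightarrow> complex" where
  "sym_prod s us = (\<lambda>\<phi>. if \<phi> \<in> dual s then \<Prod>u\<leftarrow>us. \<phi> u else 0)"

definition sym_power :: "(complex \<Rightarrow> 'u::ab_group_add \<Rightarrow> 'u) \<Rightarrow> nat \<Rightarrow> (('u \<Rightarrow> complex) \<Rightarrow> complex) set" where
  "sym_power s n = module.span fscale {sym_prod s us | us. length us = n}"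

definition sym_map ::
  "(complex \<Rightarrow> 'u::ab_group_add \<Rightarrow> 'u) \<Rightarrow> ('u \<Rightarrow> 'u) \<Rightarrow> (('u \<Rightarrow> complex) \<Rightarrow> complex) \<Rightarrow> ('u \<Rightarrow> complex) \<Rightarrow> complex" where
  "sym_map s g F = (\<lambda>\<phi>. if \<phi> \<in> dual s then F (\<phi> \<circ> g) else 0)"

lemma sym_map_sym_prod:
  assumes "Vector_Spaces.linear s s g"
  shows "sym_map s g (sym_prod s us) = sym_prod s (map g us)"
  using Vector_Spaces.linear_compose[OF assms]
  by (auto simp: sym_map_def sym_prod_def dual_def fun_eq_iff o_def)

(* Exterior square of a subspace E: the bivector v \<and> w is realised as the alternating form
   (\<phi>,\<psi>) |-> \<phi>(v) \<psi>(w) - \<phi>(w) \<psi>(v) on the dual space.  This identifies the second exterior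
   power of E with the span of the bivectors, because linear forms on E extend to the whole
   space and separate points. *)

definition wedge ::
  "(complex \<Rightarrow> 'v::ab_group_add \<Rightarrow> 'v) \<Rightarrow> 'v \<Rightarrow> 'v \<Rightarrow> ('v \<Rightarrow> complex) \<times> ('v \<Rightarrow> complex) \<Rightarrow> complex" where
  "wedge s v w = (\<lambda>(\<phi>, \<psi>). if \<phi> \<in> dual s \<and> \<psi> \<in> dual s then \<phi> v * \<psi> w - \<phi> w * \<psi> v else 0)"

definition ext_square ::
  "(complex \<Rightarrow> 'v::ab_group_add \<Rightarrow> 'v) \<Rightarrow> 'v set \<Rightarrow> (('v \<Rightarrow> complex) \<times> ('v \<Rightarrow> complex) \<Rightarrow> complex) set" where
  "ext_square s E = module.span fscale {wedge s v w | v w. v \<in> E \<and> w \<in> E}"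

definition ext_map ::
  "(complex \<Rightarrow> 'v::ab_group_add \<Rightarrow> 'v) \<Rightarrow> ('v \<Rightarrow> 'v) \<Rightarrow>
   (('v \<Rightarrow> complex) \<times> ('v \<Rightarrow> complex) \<Rightarrow> complex) \<Rightarrow> ('v \<Rightarrow> complex) \<times> ('v \<Rightarrow> complex) \<Rightarrow> complex" where
  "ext_map s A F = (\<lambda>(\<phi>, \<psi>). if \<phi> \<in> dual s \<and> \<psi> \<in> dual s then F (\<phi> \<circ> A, \<psi> \<circ> A) else 0)"

lemma ext_map_wedge:
  assumes "Vector_Spaces.linear s s A"
  shows "ext_map s A (wedge s v w) = wedge s (A v) (A w)"
  using Vector_Spaces.linear_compose[OF assms]
  by (auto simp: ext_map_def wedge_def dual_def fun_eq_iff o_def)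

definition ordered_basis2 :: "(complex \<Rightarrow> 'u::ab_group_add \<Rightarrow> 'u) \<Rightarrow> (2 \<Rightarrow> 'u) \<Rightarrow> bool" where
  "ordered_basis2 s b \<longleftrightarrow>
     inj b \<and> \<not> module.dependent s (range b) \<and> module.span s (range b) = UNIV"

definition matrix_in_basis ::
  "(complex \<Rightarrow> 'u::ab_group_add \<Rightarrow> 'u) \<Rightarrow> (2 \<Rightarrow> 'u) \<Rightarrow> ('u \<Rightarrow> 'u) \<Rightarrow> complex ^ 2 ^ 2" where
  "matrix_in_basis s b g = (\<chi> i j. module.representation s (range b) (g (b j)) (b i))"

(* SL(U) for a 2-dimensional space U. *)

definition SL :: "(complex \<Rightarrow> 'u::ab_group_add \<Rightarrow> 'u) \<Rightarrow> ('u \<Rightarrow> 'u) set" where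
  "SL s = {g. Vector_Spaces.linear s s g \<and>
              (\<forall>b. ordered_basis2 s b \<longrightarrow> det (matrix_in_basis s b g) = 1)}"

(* A representation of G is a subspace V of a space with scalar multiplication s, stable
   under the action \<rho>. *)

definition subrep ::
  "(complex \<Rightarrow> 'v::ab_group_add \<Rightarrow> 'v) \<Rightarrow> 'g set \<Rightarrow> ('g \<Rightarrow> 'v \<Rightarrow> 'v) \<Rightarrow> 'v set \<Rightarrow> bool" where
  "subrep s G \<rho> V \<longleftrightarrow> module.subspace s V \<and> (\<forall>g\<in>G. \<forall>v\<in>V. \<rho> g v \<in> V)"

definition irreducible_rep ::
  "(complex \<Rightarrow> 'v::ab_group_add \<Rightarrow> 'v) \<Rightarrow> 'g set \<Rightarrow> ('g \<Rightarrow> 'v \<Rightarrow> 'v) \<Rightarrow> 'v set \<Rightarrow> bool" where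
  "irreducible_rep s G \<rho> V \<longleftrightarrow>
     subrep s G \<rho> V \<and> V \<noteq> {0} \<and> (\<forall>X. X \<subseteq> V \<and> subrep s G \<rho> X \<longrightarrow> X = {0} \<or> X = V)"

definition rep_iso ::
  "'g set \<Rightarrow> (complex \<Rightarrow> 'v::ab_group_add \<Rightarrow> 'v) \<Rightarrow> ('g \<Rightarrow> 'v \<Rightarrow> 'v) \<Rightarrow> 'v set \<Rightarrow>
   (complex \<Rightarrow> 'w::ab_group_add \<Rightarrow> 'w) \<Rightarrow> ('g \<Rightarrow> 'w \<Rightarrow> 'w) \<Rightarrow> 'w set \<Rightarrow> bool" where
  "rep_iso G s \<rho> V t \<sigma> W \<longleftrightarrow>
     (\<exists>f. bij_betw f V W \<and>
          (\<forall>x\<in>V. \<forall>y\<in>V. f (x + y) = f x + f y) \<and>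
          (\<forall>c. \<forall>x\<in>V. f (s c x) = t c (f x)) \<and>
          (\<forall>g\<in>G. \<forall>x\<in>V. f (\<rho> g x) = \<sigma> g (f x)))"

definition sum_subspaces :: "'i set \<Rightarrow> ('i \<Rightarrow> 'v::ab_group_add set) \<Rightarrow> 'v set" where
  "sum_subspaces I V = {\<Sum>i\<in>I. x i | x. \<forall>i\<in>I. x i \<in> V i}"

definition internal_direct_sum :: "'v::ab_group_add set \<Rightarrow> 'i set \<Rightarrow> ('i \<Rightarrow> 'v set) \<Rightarrow> bool" where
  "internal_direct_sum E I V \<longleftrightarrow>
     finite I \<and> E = sum_subspaces I V \<and>
     (\<forall>x. (\<forall>i\<in>I. x i \<in> V i) \<and> (\<Sum>i\<in>I. x i) = 0 \<longrightarrow> (\<forall>i\<in>I. x i = 0))"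

definition irreducible_decomposition ::
  "(complex \<Rightarrow> 'v::ab_group_add \<Rightarrow> 'v) \<Rightarrow> 'g set \<Rightarrow> ('g \<Rightarrow> 'v \<Rightarrow> 'v) \<Rightarrow> 'v set \<Rightarrow> 'i set \<Rightarrow> ('i \<Rightarrow> 'v set) \<Rightarrow> bool" where
  "irreducible_decomposition s G \<rho> E I V \<longleftrightarrow>
     internal_direct_sum E I V \<and> (\<forall>i\<in>I. irreducible_rep s G \<rho> (V i))"

definition proj_space :: "(complex \<Rightarrow> 'v::ab_group_add \<Rightarrow> 'v) \<Rightarrow> 'v set \<Rightarrow> 'v set set" where
  "proj_space s W = {module.span s {w} | w. w \<in> W \<and> w \<noteq> 0}"

(* Integer-valued: the empty projective space P(0) has dimension -1. *)

definition proj_dim :: "(complex \<Rightarrow> 'v::ab_group_add \<Rightarrow> 'v) \<Rightarrow> 'v set \<Rightarrow> int" where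
  "proj_dim s W = int (vector_space.dim s W) - 1"

(* The Grassmannian of lines in P(E), in its Pluecker embedding in P(ext_square s E). *)

definition grassmannian_lines ::
  "(complex \<Rightarrow> 'v::ab_group_add \<Rightarrow> 'v) \<Rightarrow> 'v set \<Rightarrow> (('v \<Rightarrow> complex) \<times> ('v \<Rightarrow> complex) \<Rightarrow> complex) set set" where
  "grassmannian_lines s E =
     {module.span fscale {wedge s v w} | v w. v \<in> E \<and> w \<in> E \<and> wedge s v w \<noteq> 0}"

end

theory Submission
  imports Defs "HOL-Computational_Algebra.Polynomial"
begin

text \<open>
  Evaluation at pairs of points of \<open>U\<^sup>*\<close> identifies \<open>\<Lambda>\<^sup>2 S\<^sup>n U\<close> with the antisymmetric
  forms \<open>P(\<phi>, \<psi>)\<close> of bidegree \<open>(n, n)\<close>. With \<open>[\<phi>, \<psi>]\<close> the determinant, which is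
  \<open>SL(U)\<close>-invariant, and \<open>m = n - 1 - 2j\<close>, polarizing \<open>h \<in> S\<^bsup>2m\<^esup>U\<close> to bidegree \<open>(m, m)\<close> and
  multiplying by \<open>[\<phi>, \<psi>]\<^bsup>2j+1\<^esup>\<close> embeds \<open>S\<^bsup>2m\<^esup>U\<close> equivariantly. The images are independent,
  because dividing by the lowest power of the determinant and restricting to the diagonal recovers
  \<open>h\<close>, and they span by a dimension count. By irreducibility of the top summand and comparison of
  dimensions, the complement \<open>W\<close> in any decomposition lies in the sum of the embedded summands with
  \<open>j \<ge> 1\<close>, whose forms vanish to order three on the diagonal. If \<open>v \<and> v'\<close> is such a form, then the
  Wronskian of \<open>v\<close> and \<open>v'\<close> vanishes, so \<open>v\<close> and \<open>v'\<close> are linearly dependent.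
\<close>

section \<open>Dimensions and isomorphisms of representations\<close>

text \<open>The exponent of the determinant is odd because polarizations are symmetric while
  bivectors are antisymmetric, and m = n - 1 - 2j because the bidegree m + (2j + 1) has to be n. Two
  obstacles shape the proof. A bivector is encoded as a form on pairs of arbitrary functionals on a
  space of functions, and most of these are not evaluations at points; that evaluation at points is
  still faithful follows by contracting with one functional, which leaves a vector, and this vector
  is itself a function. Moreover, the summands \<open>V j\<close> of a given decomposition are known
  only up to isomorphism, so nothing places them among the embedded copies. Here the projection of
  \<open>V j\<close> to the top copy is a subrepresentation of it, hence zero or everything, and for
  j \<ge> 1 the inequality 2(n-1-2j) + 1 < 2n - 1 excludes the latter. The dimension count is a
  squeeze: the embedded copies give n(n+1)/2 from below, the wedges of pairs of monomials give
  n(n+1)/2 from above.\<close>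

context vector_space
begin

text \<open>The number \<open>dim V\<close> is 0 on infinite-dimensional spaces as well and does not
  tell whether \<open>V\<close> is a subspace. A finite basis as witness carries finiteness, the
  subspace property and the dimension together.\<close>

definition has_dim :: "'b set \<Rightarrow> nat \<Rightarrow> bool" where
  "has_dim V d \<longleftrightarrow> (\<exists>B. finite B \<and> independent B \<and> span B = V \<and> card B = d)"

end

text \<open>The context is reopened because \<open>has_dim\<close> would otherwise resolve to its instance for real vector spaces.\<close>

context vector_space
begin

lemma has_dim_imp_dim: "has_dim V d \<Longrightarrow> dim V = d"
  unfolding has_dim_def using dim_span_eq_card_independent by blast

lemma has_dim_imp_subspace: "has_dim V d \<Longrightarrow> subspace V"
  unfolding has_dim_def by blast

lemma has_dim_zero: "has_dim {0} 0"
  unfolding has_dim_def by (intro exI[of _ "{}"]) (simp add: independent_empty)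

lemma has_dim_le_card:
  assumes "has_dim V d" "V \<subseteq> span S" "finite S"
  shows "d \<le> card S"
  using assms dim_le_card has_dim_imp_dim by metis

lemma independent_Un:
  assumes "finite B" "independent A" "independent B" "span A \<inter> span B \<subseteq> {0}"
  shows "independent (A \<union> B)"
  using assms
proof (induction B)
  case empty
  then show ?case by simp
next
  case (insert b B)
  have "independent B" and "b \<notin> span B"
    using insert.hyps insert.prems(2) by (auto simp: independent_insert)
  have "span A \<inter> span B \<subseteq> {0}"
    using insert.prems(3) span_mono[of B "insert b B"] by blast
  then have ind: "independent (A \<union> B)"
    using insert.IH insert.prems(1) \<open>independent B\<close> by blast
  have "b \<notin> span (A \<union> B)"
  proof
    assume "b \<in> span (A \<union> B)"
    then obtain x y where xy: "b = x + y" "x \<in> span A" "y \<in> span B"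
      by (auto simp: span_Un)
    then have "x = b - y" by simp
    moreover have "b \<in> span (insert b B)" "y \<in> span (insert b B)"
      using xy span_mono[of B "insert b B"] by (auto intro: span_base)
    ultimately have "x \<in> span (insert b B)" by (simp add: span_diff)
    then have "x = 0" using xy insert.prems(3) by blast
    then show False using xy \<open>b \<notin> span B\<close> by simp
  qed
  then show ?case using independent_insertI[OF _ ind] by simp
qed

lemma has_dim_plus:
  assumes "has_dim V a" "has_dim W b" "V \<inter> W \<subseteq> {0}"
  shows "has_dim {x + y |x y. x \<in> V \<and> y \<in> W} (a + b)"
proof -
  obtain A B where A: "finite A" "independent A" "span A = V" "card A = a"
    and B: "finite B" "independent B" "span B = W" "card B = b"
    using assms(1,2) unfolding has_dim_def by metis
  have "A \<inter> B = {}"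
  proof -
    have "A \<inter> B \<subseteq> {0}" using assms(3) A(3) B(3) span_superset by blast
    moreover have "0 \<notin> A" using A(2) dependent_zero by blast
    ultimately show ?thesis by blast
  qed
  moreover have "independent (A \<union> B)"
    using independent_Un[OF B(1) A(2) B(2)] assms(3) A(3) B(3) by simp
  moreover have "span (A \<union> B) = {x + y |x y. x \<in> V \<and> y \<in> W}"
    using A(3) B(3) by (simp add: span_Un)
  ultimately show ?thesis
    unfolding has_dim_def using A B by (metis card_Un_disjoint finite_UnI)
qed

text \<open>A basis of \<open>V\<close> extends within \<open>E\<close> to an independent set
  spanning \<open>E\<close>; this set is no larger than \<open>S\<close>, so nothing was
  added.\<close>

lemma subspace_eqI_has_dim:
  assumes "has_dim V d" "V \<subseteq> E" "E \<subseteq> span S" "finite S" "card S \<le> d"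
  shows "V = E"
proof -
  obtain B where B: "finite B" "independent B" "span B = V" "card B = d"
    using assms(1) unfolding has_dim_def by metis
  obtain C where C: "B \<subseteq> C" "C \<subseteq> E" "independent C" "E \<subseteq> span C"
    using maximal_independent_subset_extend[of B E] B(2,3) assms(2) span_superset by blast
  have "finite C \<and> card C \<le> card S"
    using independent_span_bound[OF assms(4) C(3)] C(2) assms(3) by blast
  then have "B = C"
    using card_seteq[OF _ C(1)] B(4) assms(5) by simp
  then show ?thesis using C(4) B(3) assms(2) by blast
qed

lemma has_dim_sum_subspaces:
  assumes "finite I" "\<And>i. i \<in> I \<Longrightarrow> has_dim (V i) (d i)"
    and "\<And>x. \<forall>i\<in>I. x i \<in> V i \<Longrightarrow> (\<Sum>i\<in>I. x i) = 0 \<Longrightarrow> \<forall>i\<in>I. x i = 0"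
  shows "has_dim (sum_subspaces I V) (\<Sum>i\<in>I. d i)"
  using assms
proof (induction I)
  case empty
  then show ?case by (simp add: sum_subspaces_def has_dim_zero)
next
  case (insert k I)
  have V: "subspace (V i)" if "i \<in> insert k I" for i
    using insert.prems(1) that has_dim_imp_subspace by blast
  have indep: "\<forall>i\<in>I. x i = 0" if "\<forall>i\<in>I. x i \<in> V i" "(\<Sum>i\<in>I. x i) = 0" for x
  proof -
    \<comment> \<open>A relation over \<open>I\<close> becomes a relation over
      \<open>insert k I\<close> with entry 0 at \<open>k\<close>.\<close>
    have "\<forall>i\<in>insert k I. (x(k := 0)) i = 0"
    proof (rule insert.prems(2))
      show "\<forall>i\<in>insert k I. (x(k := 0)) i \<in> V i"
        using that(1) V subspace_0 by auto
      have "(\<Sum>i\<in>I. (x(k := 0)) i) = (\<Sum>i\<in>I. x i)"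
        using insert.hyps(2) by (intro sum.cong) auto
      then show "(\<Sum>i\<in>insert k I. (x(k := 0)) i) = 0"
        using insert.hyps that(2) by simp
    qed
    then show ?thesis using insert.hyps(2) by (metis fun_upd_apply insertCI)
  qed
  have split: "sum_subspaces (insert k I) V = {x + y |x y. x \<in> V k \<and> y \<in> sum_subspaces I V}"
  proof (intro set_eqI iffI)
    fix z assume "z \<in> sum_subspaces (insert k I) V"
    then obtain x where "z = (\<Sum>i\<in>insert k I. x i)" "\<forall>i\<in>insert k I. x i \<in> V i"
      unfolding sum_subspaces_def by blast
    then show "z \<in> {x + y |x y. x \<in> V k \<and> y \<in> sum_subspaces I V}"
      unfolding sum_subspaces_def using insert.hyps by auto
  next
    fix z assume "z \<in> {x + y |x y. x \<in> V k \<and> y \<in> sum_subspaces I V}"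
    then obtain a x where a: "z = a + (\<Sum>i\<in>I. x i)" "a \<in> V k" "\<forall>i\<in>I. x i \<in> V i"
      unfolding sum_subspaces_def by blast
    have "(\<Sum>i\<in>I. (x(k := a)) i) = (\<Sum>i\<in>I. x i)"
      using insert.hyps(2) by (intro sum.cong) auto
    then have "z = (\<Sum>i\<in>insert k I. (x(k := a)) i)"
      using insert.hyps a(1) by simp
    moreover have "\<forall>i\<in>insert k I. (x(k := a)) i \<in> V i" using a by auto
    ultimately show "z \<in> sum_subspaces (insert k I) V"
      unfolding sum_subspaces_def by blast
  qed
  have "V k \<inter> sum_subspaces I V \<subseteq> {0}"
  proof
    fix z assume "z \<in> V k \<inter> sum_subspaces I V"
    then obtain x where x: "z \<in> V k" "z = (\<Sum>i\<in>I. x i)" "\<forall>i\<in>I. x i \<in> V i"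
      unfolding sum_subspaces_def by blast
    \<comment> \<open>A vector \<open>z\<close> common to \<open>V k\<close> and the sum of the
      others is a relation with entry \<open>- z\<close> at \<open>k\<close>.\<close>
    have "\<forall>i\<in>insert k I. (x(k := - z)) i = 0"
    proof (rule insert.prems(2))
      show "\<forall>i\<in>insert k I. (x(k := - z)) i \<in> V i"
        using x V subspace_neg by auto
      have "(\<Sum>i\<in>I. (x(k := - z)) i) = (\<Sum>i\<in>I. x i)"
        using insert.hyps(2) by (intro sum.cong) auto
      then show "(\<Sum>i\<in>insert k I. (x(k := - z)) i) = 0"
        using insert.hyps x(2) by simp
    qed
    then show "z \<in> {0}" by simp
  qed
  then have "has_dim {x + y |x y. x \<in> V k \<and> y \<in> sum_subspaces I V} (d k + (\<Sum>i\<in>I. d i))"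
    using has_dim_plus insert.IH insert.prems(1) indep by (simp add: insert.IH)
  then show ?case using split insert.hyps by simp
qed

text \<open>The coefficients are indexed by \<open>A\<close> and not by the vectors, so the
  hypothesis also rules out repetitions: \<open>e a = e b\<close> would give a relation with
  coefficients 1 and -1.\<close>

lemma independent_indexed:
  assumes "finite A" "\<And>c. (\<Sum>a\<in>A. scale (c a) (e a)) = 0 \<Longrightarrow> \<forall>a\<in>A. c a = 0"
  shows "inj_on e A" "independent (e ` A)"
proof -
  show inj: "inj_on e A"
  proof (rule inj_onI, rule ccontr)
    fix a b assume ab: "a \<in> A" "b \<in> A" "e a = e b" "a \<noteq> b"
    define c :: "_ \<Rightarrow> 'a" where "c = (\<lambda>i. if i = a then 1 else if i = b then - 1 else 0)"
    have "(\<Sum>i\<in>A. scale (c i) (e i)) = (\<Sum>i\<in>{a, b}. scale (c i) (e i))"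
      by (rule sum.mono_neutral_right) (use assms(1) ab in \<open>auto simp: c_def\<close>)
    also have "\<dots> = 0" using ab by (simp add: c_def)
    finally show False using assms(2)[of c] ab(1) by (auto simp: c_def)
  qed
  show "independent (e ` A)"
  proof (rule independent_if_scalars_zero)
    fix f x assume f: "(\<Sum>y\<in>e ` A. scale (f y) y) = 0" and "x \<in> e ` A"
    have "(\<Sum>a\<in>A. scale ((f \<circ> e) a) (e a)) = 0"
      using f by (simp add: sum.reindex[OF inj])
    then show "f x = 0" using assms(2)[of "f \<circ> e"] \<open>x \<in> e ` A\<close> by auto
  qed (use assms(1) in simp)
qed

text \<open>The operator \<open>T\<close> minus the scalar \<open>l b\<close> kills the component
  \<open>v b\<close>, multiplies every other \<open>v a\<close> by the nonzero number
  \<open>l a - l b\<close>, and preserves \<open>X\<close>. This shortens the sum by one term. It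
  serves to extract weight vectors with a torus element.\<close>

lemma eigenvector_components:
  assumes "finite A" "Vector_Spaces.linear scale scale T" "subspace X" "T ` X \<subseteq> X"
    and "\<And>a. a \<in> A \<Longrightarrow> T (v a) = scale (l a) (v a)" "inj_on l A"
    and "(\<Sum>a\<in>A. v a) \<in> X"
  shows "\<forall>a\<in>A. v a \<in> X"
  using assms(1,5-7)
proof (induction A arbitrary: v)
  case empty
  then show ?case by simp
next
  case (insert b A)
  interpret T: Vector_Spaces.linear scale scale T by (rule assms(2))
  let ?x = "\<Sum>a\<in>insert b A. v a"
  let ?w = "\<lambda>a. scale (l a - l b) (v a)"
  have Tx: "T ?x = (\<Sum>a\<in>insert b A. scale (l a) (v a))"
    unfolding T.sum using insert.prems(1) by (intro sum.cong) auto
  have "T ?x - scale (l b) ?x = (\<Sum>a\<in>A. ?w a)"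
    unfolding Tx using insert.hyps
    by (simp add: scale_right_distrib scale_sum_right scale_left_diff_distrib sum_subtractf algebra_simps)
  moreover have "T ?x - scale (l b) ?x \<in> X"
    using insert.prems(3) assms(3,4) by (intro subspace_diff subspace_scale) auto
  ultimately have "(\<Sum>a\<in>A. ?w a) \<in> X" by simp
  then have w: "\<forall>a\<in>A. ?w a \<in> X"
    using insert.prems(1,2)
    by (intro insert.IH[where v = ?w]) (auto simp: T.scale mult.commute)
  have vA: "v a \<in> X" if "a \<in> A" for a
  proof -
    have "l a \<noteq> l b" using insert.prems(2) insert.hyps(2) that by (auto simp: inj_on_def)
    then have "v a = scale (inverse (l a - l b)) (?w a)" by simp
    then show ?thesis using w that assms(3) subspace_scale by metis
  qed
  have "v b = ?x - (\<Sum>a\<in>A. v a)" using insert.hyps by simp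
  then have "v b \<in> X"
    using insert.prems(3) vA assms(3) subspace_diff subspace_sum by metis
  then show ?case using vA by blast
qed

end

section \<open>Transport along isomorphisms of representations\<close>

lemma rep_isoE:
  assumes "rep_iso G s \<rho> V t \<sigma> W"
  obtains f where "bij_betw f V W"
    "\<And>x y. x \<in> V \<Longrightarrow> y \<in> V \<Longrightarrow> f (x + y) = f x + f y"
    "\<And>c x. x \<in> V \<Longrightarrow> f (s c x) = t c (f x)"
    "\<And>g x. g \<in> G \<Longrightarrow> x \<in> V \<Longrightarrow> f (\<rho> g x) = \<sigma> g (f x)"
  using assms unfolding rep_iso_def by blast

text \<open>The isomorphism is controlled on \<open>V\<close> only; stability of \<open>V\<close>
  under the action is what allows the inverse to be computed at
  \<open>f (\<rho> g a)\<close>.\<close>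

lemma rep_iso_sym:
  assumes iso: "rep_iso G s \<rho> V t \<sigma> W"
    and s: "vector_space s" and V: "subrep s G \<rho> V"
  shows "rep_iso G t \<sigma> W s \<rho> V"
proof -
  obtain f where f: "bij_betw f V W"
    "\<And>x y. x \<in> V \<Longrightarrow> y \<in> V \<Longrightarrow> f (x + y) = f x + f y"
    "\<And>c x. x \<in> V \<Longrightarrow> f (s c x) = t c (f x)"
    "\<And>g x. g \<in> G \<Longrightarrow> x \<in> V \<Longrightarrow> f (\<rho> g x) = \<sigma> g (f x)"
    using iso by (rule rep_isoE) blast
  interpret s: vector_space s by (rule s)
  have sub: "s.subspace V" and stab: "\<And>g x. g \<in> G \<Longrightarrow> x \<in> V \<Longrightarrow> \<rho> g x \<in> V"
    using V unfolding subrep_def by auto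
  let ?h = "inv_into V f"
  have h: "?h (f x) = x" if "x \<in> V" for x
    using f(1) that by (simp add: bij_betw_inv_into_left)
  have W: "W = f ` V" using f(1) by (simp add: bij_betw_def)
  show ?thesis
    unfolding rep_iso_def
  proof (intro exI[of _ ?h] conjI ballI allI)
    show "bij_betw ?h W V" using f(1) by (rule bij_betw_inv_into)
    fix x y assume "x \<in> W" "y \<in> W"
    then obtain a b where "x = f a" "y = f b" "a \<in> V" "b \<in> V" unfolding W by blast
    then show "?h (x + y) = ?h x + ?h y"
      using f(2)[of a b] h[of "a + b"] h[of a] h[of b] s.subspace_add[OF sub] by simp
  next
    fix c x assume "x \<in> W"
    then obtain a where "x = f a" "a \<in> V" unfolding W by blast
    then show "?h (t c x) = s c (?h x)"
      using f(3)[of a c] h[of "s c a"] h[of a] s.subspace_scale[OF sub] by simp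
  next
    fix g x assume "g \<in> G" "x \<in> W"
    then obtain a where "x = f a" "a \<in> V" unfolding W by blast
    then show "?h (\<sigma> g x) = \<rho> g (?h x)"
      using f(4)[of g a] h[of "\<rho> g a"] h[of a] stab \<open>g \<in> G\<close> by simp
  qed
qed

lemma rep_iso_irreducible:
  assumes iso: "rep_iso G s \<rho> V t \<sigma> W"
    and s: "vector_space s" and t: "vector_space t" and V: "irreducible_rep s G \<rho> V"
  shows "irreducible_rep t G \<sigma> W"
proof -
  obtain f where f: "bij_betw f V W"
    "\<And>x y. x \<in> V \<Longrightarrow> y \<in> V \<Longrightarrow> f (x + y) = f x + f y"
    "\<And>c x. x \<in> V \<Longrightarrow> f (s c x) = t c (f x)"
    "\<And>g x. g \<in> G \<Longrightarrow> x \<in> V \<Longrightarrow> f (\<rho> g x) = \<sigma> g (f x)"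
    using iso by (rule rep_isoE) blast
  interpret s: vector_space s by (rule s)
  interpret t: vector_space t by (rule t)
  have sub: "s.subspace V" and stab: "\<And>g x. g \<in> G \<Longrightarrow> x \<in> V \<Longrightarrow> \<rho> g x \<in> V"
    and "V \<noteq> {0}" and irr: "\<And>X. X \<subseteq> V \<Longrightarrow> subrep s G \<rho> X \<Longrightarrow> X = {0} \<or> X = V"
    using V unfolding irreducible_rep_def subrep_def by auto
  have W: "W = f ` V" and inj: "inj_on f V" using f(1) by (auto simp: bij_betw_def)
  have f0: "f 0 = 0"
    using f(3)[of 0 0] s.subspace_0[OF sub] by simp
  have Wsub: "t.subspace W"
  proof (rule t.subspaceI)
    show "0 \<in> W" unfolding W using f0 s.subspace_0[OF sub] by (metis image_eqI)
    show "x + y \<in> W" if xy: "x \<in> W" "y \<in> W" for x y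
    proof -
      obtain a b where "x = f a" "y = f b" "a \<in> V" "b \<in> V" using xy unfolding W by blast
      then show ?thesis using f(2)[of a b] s.subspace_add[OF sub] unfolding W by (metis image_eqI)
    qed
    show "t c x \<in> W" if x: "x \<in> W" for c x
    proof -
      obtain a where "x = f a" "a \<in> V" using x unfolding W by blast
      then show ?thesis using f(3)[of a c] s.subspace_scale[OF sub] unfolding W by (metis image_eqI)
    qed
  qed
  have "\<sigma> g x \<in> W" if gx: "g \<in> G" "x \<in> W" for g x
  proof -
    obtain a where "x = f a" "a \<in> V" using gx unfolding W by blast
    then show ?thesis using f(4)[of g a] stab[of g a] gx unfolding W by (metis image_eqI)
  qed
  then have "subrep t G \<sigma> W"
    unfolding subrep_def using Wsub by blast
  moreover have "W \<noteq> {0}"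
  proof
    assume "W = {0}"
    moreover have "f x \<in> W" if "x \<in> V" for x unfolding W using that by (rule imageI)
    ultimately have "f x = f 0" if "x \<in> V" for x using that f0 by simp
    then have "V \<subseteq> {0}" using inj_onD[OF inj _ _ s.subspace_0[OF sub]] by blast
    then show False using \<open>V \<noteq> {0}\<close> s.subspace_0[OF sub] by blast
  qed
  moreover have "X = {0} \<or> X = W" if X: "X \<subseteq> W" "subrep t G \<sigma> X" for X
  proof -
    have Xsub: "t.subspace X" and Xstab: "\<And>g x. g \<in> G \<Longrightarrow> x \<in> X \<Longrightarrow> \<sigma> g x \<in> X"
      using X(2) unfolding subrep_def by auto
    \<comment> \<open>Irreducibility is tested on preimages, which are subrepresentations of
      \<open>V\<close>.\<close>
    let ?Y = "{x \<in> V. f x \<in> X}"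
    have "s.subspace ?Y"
    proof (rule s.subspaceI)
      show "0 \<in> ?Y" using s.subspace_0[OF sub] t.subspace_0[OF Xsub] f0 by simp
      show "x + y \<in> ?Y" if "x \<in> ?Y" "y \<in> ?Y" for x y
        using that s.subspace_add[OF sub] t.subspace_add[OF Xsub] f(2) by simp
      show "s c x \<in> ?Y" if "x \<in> ?Y" for c x
        using that s.subspace_scale[OF sub] t.subspace_scale[OF Xsub] f(3) by simp
    qed
    then have "subrep s G \<rho> ?Y"
      unfolding subrep_def using stab Xstab f(4) by auto
    then have "?Y = {0} \<or> ?Y = V" by (intro irr) auto
    moreover have X: "X = f ` ?Y" using X(1) unfolding W by blast
    have "X = {0}" if "?Y = {0}"
      using X unfolding that by (simp add: f0)
    moreover have "X = W" if "?Y = V"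
      using X unfolding that W .
    ultimately show ?thesis by blast
  qed
  ultimately show ?thesis unfolding irreducible_rep_def by blast
qed

text \<open>Since \<open>f\<close> is linear merely on the subspace \<open>V\<close>, it is replaced
  by a linear map \<open>g\<close> of the whole spaces that agrees with \<open>f\<close> on a basis,
  hence on \<open>V\<close>; images of bases under \<open>g\<close> are then available.\<close>

lemma rep_iso_has_dim:
  assumes iso: "rep_iso G s \<rho> V t \<sigma> W"
    and s: "vector_space s" and t: "vector_space t" and V: "vector_space.has_dim s V d"
  shows "vector_space.has_dim t W d"
proof -
  obtain f where f: "bij_betw f V W"
    "\<And>x y. x \<in> V \<Longrightarrow> y \<in> V \<Longrightarrow> f (x + y) = f x + f y"
    "\<And>c x. x \<in> V \<Longrightarrow> f (s c x) = t c (f x)"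
    using iso by (rule rep_isoE) blast
  interpret s: vector_space s by (rule s)
  interpret t: vector_space t by (rule t)
  interpret st: vector_space_pair s t ..
  obtain B where B: "finite B" "s.independent B" "s.span B = V" "card B = d"
    using V unfolding s.has_dim_def by blast
  obtain g where g: "Vector_Spaces.linear s t g" "\<forall>x\<in>B. g x = f x"
    using st.linear_independent_extend[OF B(2)] by blast
  interpret g: Vector_Spaces.linear s t g by (rule g(1))
  have "x \<in> V \<and> g x = f x" if "x \<in> s.span B" for x
    using that
  proof (induction rule: s.span_induct_alt)
    case base
    show ?case using f(3)[of 0 0] B(3) s.span_zero[of B] by (auto simp: g.zero)
  next
    case (step c x y)
    have "x \<in> V" using step.hyps B(3) s.span_superset by blast
    then have "s c x \<in> V" using B(3) s.span_scale by blast
    then show ?case using step f \<open>x \<in> V\<close> g(2) B(3) s.span_add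
      by (simp add: g.add g.scale) (metis s.span_add)
  qed
  then have gV: "g x = f x" if "x \<in> V" for x using that B(3) by blast
  have inj: "inj_on g V"
    using f(1) gV by (simp add: bij_betw_def cong: inj_on_cong)
  have W: "W = g ` V"
    using f(1) gV by (simp add: bij_betw_def)
  have "B \<subseteq> V" using B(3) s.span_superset by blast
  have "t.independent (g ` B)"
    using g.independent_injective_image[OF B(2)] inj B(3) by simp
  moreover have "t.span (g ` B) = W" using g.span_image B(3) W by simp
  moreover have "card (g ` B) = d"
    using inj \<open>B \<subseteq> V\<close> B(4) by (metis card_image inj_on_subset)
  ultimately show ?thesis unfolding t.has_dim_def using B(1) by blast
qed

section \<open>Coordinates on the plane\<close>

interpretation fs: vector_space fscale
  by (rule vector_space_fscale)

lemma dual_add: "\<phi> \<in> dual s \<Longrightarrow> \<phi> (x + y) = \<phi> x + \<phi> y"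
  and dual_scale: "\<phi> \<in> dual s \<Longrightarrow> \<phi> (s c x) = c * \<phi> x"
  unfolding dual_def by (auto dest: Vector_Spaces.linear_iff[THEN iffD1])

lemma dual_comp: "\<phi> \<in> dual t \<Longrightarrow> Vector_Spaces.linear s t g \<Longrightarrow> \<phi> \<circ> g \<in> dual s"
  unfolding dual_def using Vector_Spaces.linear_compose by blast

lemma dualI:
  assumes "vector_space s" "\<And>x y. \<phi> (x + y) = \<phi> x + \<phi> y" "\<And>c x. \<phi> (s c x) = c * \<phi> x"
  shows "\<phi> \<in> dual s"
  using assms unfolding dual_def Vector_Spaces.linear_iff
  by (auto intro: vector_space_over_itself.vector_space_axioms)

lemma dual_lincomb:
  assumes "vector_space s" "\<phi> \<in> dual s" "\<psi> \<in> dual s"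
  shows "(\<lambda>u. \<phi> u + t * \<psi> u) \<in> dual s"
  by (rule dualI) (use assms in \<open>auto simp: dual_add dual_scale algebra_simps\<close>)

lemma ev_dual: "(\<lambda>F. F \<phi>) \<in> dual fscale"
  by (rule dualI) (auto simp: fscale_def vector_space_fscale)

locale plane = vector_space s for s :: "complex \<Rightarrow> 'u::ab_group_add \<Rightarrow> 'u" +
  fixes u0 u1 :: 'u
  assumes neq: "u0 \<noteq> u1" and indep: "independent {u0, u1}" and spans: "span {u0, u1} = UNIV"
begin

definition coord0 :: "'u \<Rightarrow> complex" where "coord0 u = representation {u0, u1} u u0"
definition coord1 :: "'u \<Rightarrow> complex" where "coord1 u = representation {u0, u1} u u1"

lemma coords: "u = s (coord0 u) u0 + s (coord1 u) u1"
proof -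
  have "(\<Sum>b\<in>{u0, u1}. s (representation {u0, u1} u b) b) = u"
    by (rule sum_representation_eq) (auto simp: indep spans)
  then show ?thesis using neq by (simp add: coord0_def coord1_def)
qed

lemma coord_add [simp]: "coord0 (u + v) = coord0 u + coord0 v" "coord1 (u + v) = coord1 u + coord1 v"
  and coord_scale [simp]: "coord0 (s c u) = c * coord0 u" "coord1 (s c u) = c * coord1 u"
  by (auto simp: coord0_def coord1_def representation_add representation_scale indep spans)

lemma coord_basis [simp]: "coord0 u0 = 1" "coord0 u1 = 0" "coord1 u0 = 0" "coord1 u1 = 1"
  using neq by (auto simp: coord0_def coord1_def representation_basis indep)

lemma dual_coords: "\<phi> \<in> dual s \<Longrightarrow> \<phi> u = coord0 u * \<phi> u0 + coord1 u * \<phi> u1"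
  using dual_add[of \<phi> s] dual_scale[of \<phi> s] coords[of u] by metis

text \<open>These are all linear forms, given by their values on the basis. The points
  \<open>covec 1 z\<close> form the affine chart of the dual plane on which forms turn into
  polynomials in one variable.\<close>

definition covec :: "complex \<Rightarrow> complex \<Rightarrow> 'u \<Rightarrow> complex" where
  "covec x y = (\<lambda>u. coord0 u * x + coord1 u * y)"

lemma covec_dual [simp]: "covec x y \<in> dual s"
  by (rule dualI) (auto simp: covec_def algebra_simps vector_space_axioms)

lemma covec_basis [simp]: "covec x y u0 = x" "covec x y u1 = y"
  by (auto simp: covec_def)

definition lin :: "'u \<Rightarrow> 'u \<Rightarrow> 'u \<Rightarrow> 'u" where
  "lin v w = (\<lambda>u. s (coord0 u) v + s (coord1 u) w)"

lemma linear_lin: "Vector_Spaces.linear s s (lin v w)"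
  unfolding Vector_Spaces.linear_iff
  by (auto simp: lin_def vector_space_axioms scale_left_distrib scale_right_distrib algebra_simps)

lemma lin_basis [simp]: "lin v w u0 = v" "lin v w u1 = w"
  by (auto simp: lin_def)

definition bracket :: "('u \<Rightarrow> complex) \<Rightarrow> ('u \<Rightarrow> complex) \<Rightarrow> complex" where
  "bracket \<phi> \<psi> = \<phi> u0 * \<psi> u1 - \<phi> u1 * \<psi> u0"

text \<open>Multiplicativity of the 2 by 2 determinant: the values of \<open>\<phi>\<close>,
  \<open>\<psi>\<close> on \<open>v\<close>, \<open>w\<close> form the product of their values on
  the basis with the coordinate matrix of \<open>v\<close>, \<open>w\<close>.\<close>

lemma bracket_comp:
  assumes "\<phi> \<in> dual s" "\<psi> \<in> dual s"
  shows "\<phi> v * \<psi> w - \<phi> w * \<psi> v = (coord0 v * coord1 w - coord1 v * coord0 w) * bracket \<phi> \<psi>"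
  unfolding bracket_def dual_coords[OF assms(1), of v] dual_coords[OF assms(1), of w]
    dual_coords[OF assms(2), of v] dual_coords[OF assms(2), of w]
  by (simp add: algebra_simps)

end

section \<open>The group SL(U) and the invariance of the bracket\<close>

lemma range_2: "range (b :: 2 \<Rightarrow> 'a) = {b 1, b 2}"
  by (simp add: UNIV_2)

lemma ordered_basis2_plane:
  assumes "vector_space s" "ordered_basis2 s b"
  shows "plane s (b 1) (b 2)"
proof -
  interpret vector_space s by (rule assms(1))
  have "inj b" using assms(2) by (simp add: ordered_basis2_def)
  then have "b 1 \<noteq> b 2" by (auto dest: injD)
  then show ?thesis
    by unfold_locales (use assms(2) in \<open>auto simp: ordered_basis2_def range_2\<close>)
qed

lemma (in plane) det_matrix_in_basis:
  assumes "b 1 = u0" "b 2 = u1"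
  shows "det (matrix_in_basis s b g) = coord0 (g u0) * coord1 (g u1) - coord1 (g u0) * coord0 (g u1)"
  using assms by (simp add: det_2 matrix_in_basis_def range_2 coord0_def coord1_def)

lemma (in plane) SL_bracket:
  assumes "g \<in> SL s" "\<phi> \<in> dual s" "\<psi> \<in> dual s"
  shows "bracket (\<phi> \<circ> g) (\<psi> \<circ> g) = bracket \<phi> \<psi>"
proof -
  define b :: "2 \<Rightarrow> 'u" where "b = (\<lambda>i. if i = 1 then u0 else u1)"
  have b: "b 1 = u0" "b 2 = u1" by (auto simp: b_def)
  have "inj b"
    unfolding inj_def forall_2 using b neq by simp
  then have "ordered_basis2 s b"
    using indep spans b by (simp add: ordered_basis2_def range_2)
  then have "det (matrix_in_basis s b g) = 1" using assms(1) by (simp add: SL_def)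
  then show ?thesis
    using bracket_comp[OF assms(2,3), of "g u0" "g u1"] det_matrix_in_basis[OF b, of g]
    by (simp add: bracket_def)
qed

text \<open>Membership in \<open>SL s\<close> concerns every ordered basis. The bracket of another
  basis is a constant multiple of the fixed one, so it is invariant too; on the basis dual to
  \<open>b\<close> it has the value 1, and after composing with \<open>g\<close> its value is the
  determinant.\<close>

lemma (in plane) SLI:
  assumes lin: "Vector_Spaces.linear s s g"
    and bracket: "\<And>\<phi> \<psi>. \<phi> \<in> dual s \<Longrightarrow> \<psi> \<in> dual s \<Longrightarrow> bracket (\<phi> \<circ> g) (\<psi> \<circ> g) = bracket \<phi> \<psi>"
  shows "g \<in> SL s"
proof -
  have "det (matrix_in_basis s b g) = 1" if b: "ordered_basis2 s b" for b
  proof -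
    interpret p: plane s "b 1" "b 2"
      by (rule ordered_basis2_plane[OF vector_space_axioms b])
    define \<phi> where "\<phi> = p.covec 1 0"
    define \<psi> where "\<psi> = p.covec 0 1"
    have d: "\<phi> \<in> dual s" "\<psi> \<in> dual s" and p1: "p.bracket \<phi> \<psi> = 1"
      by (auto simp: \<phi>_def \<psi>_def p.bracket_def)
    have dg: "\<phi> \<circ> g \<in> dual s" "\<psi> \<circ> g \<in> dual s"
      using d lin dual_comp by blast+
    have "p.bracket (\<phi> \<circ> g) (\<psi> \<circ> g) = p.bracket \<phi> \<psi>"
      unfolding p.bracket_def bracket_comp[OF dg] bracket_comp[OF d] bracket[OF d] ..
    moreover have "p.bracket (\<phi> \<circ> g) (\<psi> \<circ> g) = det (matrix_in_basis s b g) * p.bracket \<phi> \<psi>"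
      using p.bracket_comp[OF d, of "g (b 1)" "g (b 2)"] p.det_matrix_in_basis[OF refl refl, of g]
      by (simp add: p.bracket_def)
    ultimately show ?thesis using p1 by simp
  qed
  then show ?thesis using lin by (simp add: SL_def)
qed

lemma SL_linear: "g \<in> SL s \<Longrightarrow> Vector_Spaces.linear s s g"
  by (simp add: SL_def)

lemma SL_dual: "g \<in> SL s \<Longrightarrow> \<phi> \<in> dual s \<Longrightarrow> \<phi> \<circ> g \<in> dual s"
  using SL_linear dual_comp by blast

lemma (in vector_space) exists_plane:
  assumes "dim UNIV = 2"
  shows "\<exists>u0 u1. u0 \<noteq> u1 \<and> independent {u0, u1} \<and> span {u0, u1} = UNIV"
proof -
  obtain B where B: "independent B" "UNIV \<subseteq> span B" "card B = 2"
    using basis_exists[of UNIV] assms by metis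
  then obtain u0 u1 where "B = {u0, u1}" "u0 \<noteq> u1" by (auto simp: card_2_iff)
  then show ?thesis using B by blast
qed

section \<open>Symmetric powers\<close>

lemma fscale_apply [simp]: "fscale c f x = c * f x"
  by (simp add: fscale_def)

lemma sum_fun_apply: "(\<Sum>a\<in>A. f a) x = (\<Sum>a\<in>A. f a x)"
  by (induction A rule: infinite_finite_induct) auto

lemma linear_sym_map: "Vector_Spaces.linear fscale fscale (sym_map s g)"
  unfolding Vector_Spaces.linear_iff
  by (auto simp: vector_space_fscale sym_map_def fun_eq_iff)

lemma sym_power_subspace: "fs.subspace (sym_power s d)"
  by (simp add: sym_power_def)

lemma sym_prod_in_sym_power: "length us = d \<Longrightarrow> sym_prod s us \<in> sym_power s d"
  unfolding sym_power_def by (auto intro: fs.span_base)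

lemma sym_power_outside: "F \<in> sym_power s d \<Longrightarrow> \<phi> \<notin> dual s \<Longrightarrow> F \<phi> = 0"
  unfolding sym_power_def
  by (induction rule: fs.span_induct_alt) (auto simp: sym_prod_def)

lemma sym_map_sym_power:
  assumes "Vector_Spaces.linear s s g" "F \<in> sym_power s d"
  shows "sym_map s g F \<in> sym_power s d"
proof -
  interpret m: Vector_Spaces.linear fscale fscale "sym_map s g"
    by (rule linear_sym_map)
  show ?thesis
    using assms(2) unfolding sym_power_def
  proof (induction rule: fs.span_induct_alt)
    case base
    show ?case unfolding m.zero by (rule fs.span_zero)
  next
    case (step c x y)
    from step(1) obtain us where us: "x = sym_prod s us" "length us = d" by blast
    then have "sym_map s g x \<in> fs.span {sym_prod s us |us. length us = d}"
      using sym_map_sym_prod[OF assms(1)] by (auto intro!: fs.span_base)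
    then show ?case unfolding m.add m.scale by (intro fs.span_add fs.span_scale step(2))
  qed
qed

lemma subrep_sym_power: "subrep fscale (SL s) (sym_map s) (sym_power s d)"
  unfolding subrep_def using sym_power_subspace sym_map_sym_power SL_linear by blast

lemma sym_power_mult:
  assumes "F \<in> sym_power s a" "H \<in> sym_power s b"
  shows "F * H \<in> sym_power s (a + b)"
proof -
  have *: "sym_prod s us * H \<in> sym_power s (length us + b)" for us
    using assms(2) unfolding sym_power_def[of s b]
  proof (induction rule: fs.span_induct_alt)
    case base
    have "sym_prod s us * 0 = 0" by (simp add: fun_eq_iff)
    then show ?case using fs.subspace_0[OF sym_power_subspace] by metis
  next
    case (step k x y)
    from step(1) obtain vs where vs: "x = sym_prod s vs" "length vs = b" by blast
    have "sym_prod s us * x = sym_prod s (us @ vs)"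
      using vs by (auto simp: sym_prod_def fun_eq_iff)
    then have "sym_prod s us * x \<in> sym_power s (length us + b)"
      using vs by (auto intro: sym_prod_in_sym_power)
    moreover have "sym_prod s us * (fscale k x + y) = fscale k (sym_prod s us * x) + sym_prod s us * y"
      by (auto simp: fun_eq_iff algebra_simps)
    ultimately show ?case
      using step(2) fs.subspace_add fs.subspace_scale sym_power_subspace by metis
  qed
  show ?thesis
    using assms(1) unfolding sym_power_def[of s a]
  proof (induction rule: fs.span_induct_alt)
    case base
    have "0 * H = 0" by (simp add: fun_eq_iff)
    then show ?case using fs.subspace_0[OF sym_power_subspace] by metis
  next
    case (step k x y)
    then have "x * H \<in> sym_power s (a + b)" using * by auto
    moreover have "(fscale k x + y) * H = fscale k (x * H) + y * H"
      by (auto simp: fun_eq_iff algebra_simps)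
    ultimately show ?case
      using step(2) fs.subspace_add fs.subspace_scale sym_power_subspace by metis
  qed
qed

section \<open>Binary forms in coordinates: dimension and irreducibility\<close>

context plane
begin

text \<open>The homogenization of \<open>p\<close> to degree \<open>d\<close> in the coordinates
  \<open>\<phi> u0\<close> and \<open>\<phi> u1\<close>; coefficients of \<open>p\<close> beyond
  \<open>d\<close> are dropped, so statements that recover \<open>p\<close> assume a degree
  bound.\<close>

definition homog :: "nat \<Rightarrow> complex poly \<Rightarrow> ('u \<Rightarrow> complex) \<Rightarrow> complex" where
  "homog d p = (\<lambda>\<phi>. if \<phi> \<in> dual s then \<Sum>a\<le>d. coeff p a * \<phi> u0 ^ (d - a) * \<phi> u1 ^ a else 0)"

lemma homog_add: "homog d (p + q) = homog d p + homog d q"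
  and homog_smult: "homog d (smult c p) = fscale c (homog d p)"
  and homog_0: "homog d 0 = 0"
  by (auto simp: homog_def fun_eq_iff algebra_simps sum.distrib sum_distrib_left)

lemma homog_covec: "degree p \<le> d \<Longrightarrow> homog d p (covec 1 z) = poly p z"
  unfolding homog_def poly_altdef
  by (auto intro!: sum.mono_neutral_right le_degree)

definition monomial :: "nat \<Rightarrow> nat \<Rightarrow> ('u \<Rightarrow> complex) \<Rightarrow> complex" where
  "monomial d a = sym_prod s (replicate (d - a) u0 @ replicate a u1)"

lemma monomial_apply: "monomial d a \<phi> = (if \<phi> \<in> dual s then \<phi> u0 ^ (d - a) * \<phi> u1 ^ a else 0)"
  by (simp add: monomial_def sym_prod_def)

lemma monomial_in: "a \<le> d \<Longrightarrow> monomial d a \<in> sym_power s d"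
  unfolding monomial_def by (auto intro: sym_prod_in_sym_power)

lemma homog_monomial: "homog d p = (\<Sum>a\<le>d. fscale (coeff p a) (monomial d a))"
  by (auto simp: fun_eq_iff homog_def sum_fun_apply monomial_apply mult.assoc)

lemma sym_prod_homog: "\<exists>p. degree p \<le> length us \<and> sym_prod s us = homog (length us) p"
proof (induction us)
  case Nil
  show ?case by (intro exI[of _ 1]) (auto simp: sym_prod_def homog_def fun_eq_iff)
next
  case (Cons u us)
  let ?d = "length us"
  obtain p where p: "degree p \<le> ?d" "sym_prod s us = homog ?d p"
    using Cons by blast
  \<comment> \<open>The linear form \<open>u\<close> dehomogenizes to \<open>coord0 u\<close> +
    \<open>coord1 u\<close> X, and \<open>?q\<close> is its product with \<open>p\<close>.\<close>
  let ?q = "smult (coord0 u) p + smult (coord1 u) (pCons 0 p)"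
  have "degree (smult (coord0 u) p) \<le> Suc ?d"
    using p(1) degree_smult_le[of "coord0 u" p] by linarith
  moreover have "degree (smult (coord1 u) (pCons 0 p)) \<le> Suc ?d"
    using p(1) degree_smult_le[of "coord1 u" "pCons 0 p"] degree_pCons_le[of 0 p] by linarith
  ultimately have deg: "degree ?q \<le> Suc ?d"
    by (rule degree_add_le)
  have A: "homog (Suc ?d) p \<phi> = \<phi> u0 * homog ?d p \<phi>" for \<phi>
    using p(1) by (auto simp: homog_def coeff_eq_0 sum_distrib_left Suc_diff_le algebra_simps intro!: sum.cong)
  have B: "homog (Suc ?d) (pCons 0 p) \<phi> = \<phi> u1 * homog ?d p \<phi>" for \<phi>
    by (auto simp: homog_def sum.atMost_Suc_shift sum_distrib_left algebra_simps intro!: sum.cong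
        simp del: sum.atMost_Suc)
  have "sym_prod s (u # us) \<phi> = homog (Suc ?d) ?q \<phi>" for \<phi>
  proof (cases "\<phi> \<in> dual s")
    case True
    have "sym_prod s (u # us) \<phi> = \<phi> u * sym_prod s us \<phi>"
      using True by (simp add: sym_prod_def)
    also have "\<dots> = homog (Suc ?d) ?q \<phi>"
      unfolding p(2) dual_coords[OF True, of u]
      by (simp only: homog_add homog_smult plus_fun_apply fscale_apply A B) (simp add: algebra_simps)
    finally show ?thesis .
  next
    case False
    then show ?thesis by (simp add: sym_prod_def homog_def)
  qed
  then show ?case using deg by (intro exI[of _ ?q]) (auto simp: fun_eq_iff)
qed

lemma sym_powerE:
  assumes "F \<in> sym_power s d"
  obtains p where "degree p \<le> d" "F = homog d p"
proof -
  have "\<exists>p. degree p \<le> d \<and> F = homog d p"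
    using assms unfolding sym_power_def
  proof (induction rule: fs.span_induct_alt)
    case base
    show ?case by (intro exI[of _ 0]) (simp add: homog_0)
  next
    case (step c x y)
    then obtain p q where "degree p \<le> d" "x = homog d p" "degree q \<le> d" "y = homog d q"
      using sym_prod_homog by blast
    then show ?case
      by (intro exI[of _ "smult c p + q"])
        (auto simp: homog_add homog_smult intro!: degree_add_le degree_smult_le[THEN order_trans])
  qed
  then show ?thesis using that by blast
qed

lemma sym_power_poly:
  assumes "F \<in> sym_power s d"
  obtains p where "degree p \<le> d" "F = homog d p" "\<And>z. F (covec 1 z) = poly p z"
  using assms sym_powerE homog_covec by metis

text \<open>The chart omits one point of the projective line, but a form of known degree is
  determined by its dehomogenization, and a complex polynomial that vanishes everywhere is
  zero.\<close>

lemma sym_power_eq_0: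
  assumes "F \<in> sym_power s d" "\<And>z. F (covec 1 z) = 0"
  shows "F = 0"
proof -
  obtain p where p: "F = homog d p" "\<And>z. F (covec 1 z) = poly p z"
    using assms(1) sym_power_poly by metis
  then have "poly p = poly 0" using assms(2) by auto
  then show ?thesis using p(1) homog_0 by (simp add: poly_eq_poly_eq_iff)
qed

lemma sym_power_has_dim: "fs.has_dim (sym_power s d) (d + 1)"
proof -
  have ind: "\<forall>a\<in>{..d}. c a = 0" if "(\<Sum>a\<in>{..d}. fscale (c a) (monomial d a)) = 0" for c
  proof -
    let ?p = "\<Sum>a\<le>d. monom (c a) a"
    have covec: "coeff ?p a = c a" if "a \<le> d" for a
      using that by (simp add: coeff_sum)
    have deg: "degree ?p \<le> d"
      by (intro degree_sum_le) (auto intro: degree_monom_le[THEN order_trans])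
    have "homog d ?p = 0"
      using that covec unfolding homog_monomial by (metis (no_types, lifting) atMost_iff sum.cong)
    then have "poly ?p = poly 0" using homog_covec[OF deg] by auto
    then have "?p = 0" by (simp add: poly_eq_poly_eq_iff)
    then show ?thesis using covec by (metis atMost_iff coeff_0)
  qed
  have "inj_on (monomial d) {..d}" "fs.independent (monomial d ` {..d})"
    using fs.independent_indexed[of "{..d}" "monomial d"] ind by auto
  moreover have "fs.span (monomial d ` {..d}) = sym_power s d"
  proof
    show "fs.span (monomial d ` {..d}) \<subseteq> sym_power s d"
      by (rule fs.span_minimal) (auto intro: monomial_in sym_power_subspace)
    show "sym_power s d \<subseteq> fs.span (monomial d ` {..d})"
    proof
      fix F assume "F \<in> sym_power s d"
      then obtain p where "F = homog d p" by (rule sym_powerE)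
      then show "F \<in> fs.span (monomial d ` {..d})"
        unfolding homog_monomial by (auto intro!: fs.span_sum intro: fs.span_scale fs.span_base)
    qed
  qed
  ultimately show ?thesis
    unfolding fs.has_dim_def by (intro exI[of _ "monomial d ` {..d}"]) (simp add: card_image)
qed

lemma lin_in_SL:
  assumes "coord0 v * coord1 w - coord1 v * coord0 w = 1"
  shows "lin v w \<in> SL s"
proof (rule SLI[OF linear_lin])
  fix \<phi> \<psi> assume "\<phi> \<in> dual s" "\<psi> \<in> dual s"
  then show "bracket (\<phi> \<circ> lin v w) (\<psi> \<circ> lin v w) = bracket \<phi> \<psi>"
    using bracket_comp[of \<phi> \<psi> v w] assms by (simp add: bracket_def)
qed

lemma sym_power_irreducible: "irreducible_rep fscale (SL s) (sym_map s) (sym_power s d)"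
proof -
  have full: "X = sym_power s d"
    if X: "X \<subseteq> sym_power s d" "subrep fscale (SL s) (sym_map s) X" "X \<noteq> {0}" for X
  proof -
    have sub: "fs.subspace X" and stab: "\<And>g F. g \<in> SL s \<Longrightarrow> F \<in> X \<Longrightarrow> sym_map s g F \<in> X"
      using X(2) unfolding subrep_def by auto
    define T where "T = lin (s 2 u0) (s (1/2) u1)"
    define A where "A = lin (u0 + u1) u1"
    define B where "B = lin u0 (u0 + u1)"
    have SL: "T \<in> SL s" "A \<in> SL s" "B \<in> SL s"
      unfolding T_def A_def B_def by (auto intro!: lin_in_SL)
    \<comment> \<open>The torus element \<open>T\<close> has distinct eigenvalues on the monomials; \<open>A\<close> then produces \<open>\<phi> u1 ^ d\<close>
      from any monomial, and \<open>B\<close> produces every monomial from \<open>\<phi> u1 ^ d\<close>.\<close>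
    have comp: "monomial d a \<in> X" if "homog d p \<in> X" "a \<le> d" "coeff p a \<noteq> 0" for p a
    proof -
      have "\<forall>a\<in>{..d}. fscale (coeff p a) (monomial d a) \<in> X"
      proof (rule fs.eigenvector_components)
        show "Vector_Spaces.linear fscale fscale (sym_map s T)" by (rule linear_sym_map)
        show "sym_map s T ` X \<subseteq> X" using stab SL by blast
        show "(\<Sum>a\<in>{..d}. fscale (coeff p a) (monomial d a)) \<in> X"
          using that(1) by (simp add: homog_monomial)
        show "sym_map s T (fscale (coeff p a) (monomial d a)) =
              fscale (2 ^ (d - a) * (1/2) ^ a) (fscale (coeff p a) (monomial d a))" for a
          using SL_dual[OF SL(1)]
          by (auto simp: fun_eq_iff sym_map_def monomial_apply T_def dual_scale power_mult_distrib power_divide)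
        show "inj_on (\<lambda>a. 2 ^ (d - a) * (1/2) ^ a :: complex) {..d}"
        proof (rule inj_onI)
          fix a b assume "a \<in> {..d}" "b \<in> {..d}"
            and eq: "2 ^ (d - a) * (1/2) ^ a = (2 ^ (d - b) * (1/2) ^ b :: complex)"
          \<comment> \<open>The eigenvalue is 2 to the power d - 2a. Written as a quotient by
            \<open>4 ^ a\<close>, it can be compared in the natural numbers, where powers of 4 are
            distinct.\<close>
          have red: "(2 ^ (d - a) * (1/2) ^ a :: complex) = 2 ^ d / 4 ^ a" if "a \<le> d" for a
            using that by (simp add: power_diff power_divide power_mult_distrib[symmetric])
          from eq have "(4 ^ a :: complex) = 4 ^ b"
            using \<open>a \<in> {..d}\<close> \<open>b \<in> {..d}\<close> by (simp add: red)
          then have "(of_nat (4 ^ a) :: complex) = of_nat (4 ^ b)" by simp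
          then have "(4 ^ a :: nat) = 4 ^ b" by (simp only: of_nat_eq_iff)
          then show "a = b" by simp
        qed
      qed (use sub in auto)
      then have "fscale (inverse (coeff p a)) (fscale (coeff p a) (monomial d a)) \<in> X"
        using that(2) sub fs.subspace_scale by blast
      then show ?thesis using that(3) by simp
    qed
    obtain F where F: "F \<in> X" "F \<noteq> 0" using X(3) fs.subspace_0[OF sub] by blast
    then obtain p where p: "degree p \<le> d" "F = homog d p" using X(1) sym_powerE by blast
    then have "p \<noteq> 0" using F(2) homog_0 by auto
    then obtain a where a: "a \<le> d" "coeff p a \<noteq> 0" using p(1) leading_coeff_neq_0 by blast
    have "monomial d a \<in> X" using comp a F(1) p(2) by blast
    then have "sym_map s A (monomial d a) \<in> X" using stab SL by blast
    moreover then obtain q where q: "sym_map s A (monomial d a) = homog d q" using X(1) sym_powerE by blast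
    \<comment> \<open>The coefficient of \<open>\<phi> u1 ^ d\<close> is the value at
      \<open>covec 0 1\<close>, where the other monomials vanish. Composed with \<open>A\<close>,
      this covector takes the value 1 on both basis vectors, hence so does every monomial at
      it.\<close>
    moreover have "coeff q d = 1"
    proof -
      have "covec 0 1 \<circ> A \<in> dual s" using SL_dual[OF SL(2)] by simp
      then have "homog d q (covec 0 1) = 1"
        unfolding q[symmetric] by (simp add: sym_map_def monomial_apply) (simp add: A_def covec_def)
      moreover have "homog d q (covec 0 1) = (\<Sum>a\<le>d. if a = d then coeff q a else 0)"
      proof -
        have "homog d q (covec 0 1) = (\<Sum>a\<le>d. coeff q a * 0 ^ (d - a) * 1 ^ a)"
          by (simp add: homog_def)
        also have "\<dots> = (\<Sum>a\<le>d. if a = d then coeff q a else 0)"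
          by (rule sum.cong) auto
        finally show ?thesis .
      qed
      ultimately show ?thesis by simp
    qed
    ultimately have "monomial d d \<in> X" using comp[of q d] by simp
    then have BX: "sym_map s B (monomial d d) \<in> X" using stab SL by blast
    \<comment> \<open>This is (1 + X)^d, the dehomogenization of the d-th power of
      \<open>u0 + u1\<close>. In characteristic 0 its coefficients up to degree d are nonzero, so
      the torus argument extracts every monomial.\<close>
    define r :: "complex poly" where "r = (\<Sum>a\<le>d. monom (of_nat (d choose a)) a)"
    have r: "coeff r a = of_nat (d choose a)" if "a \<le> d" for a
      using that by (simp add: r_def coeff_sum)
    have "sym_map s B (monomial d d) = homog d r"
    proof
      fix \<phi>
      show "sym_map s B (monomial d d) \<phi> = homog d r \<phi>"
      proof (cases "\<phi> \<in> dual s")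
        case True
        then have "sym_map s B (monomial d d) \<phi> = (\<phi> u1 + \<phi> u0) ^ d"
          using SL_dual[OF SL(3) True]
          by (simp add: sym_map_def monomial_apply) (simp add: B_def dual_add[OF True] add.commute)
        also have "\<dots> = homog d r \<phi>"
          using True unfolding binomial_ring by (simp add: homog_def r mult_ac)
        finally show ?thesis .
      qed (simp add: sym_map_def homog_def)
    qed
    then have "homog d r \<in> X" using BX by simp
    then have mX: "monomial d b \<in> X" if "b \<le> d" for b
      using comp[of r b] that r[OF that] by simp
    have "sym_power s d \<subseteq> X"
    proof
      fix F assume "F \<in> sym_power s d"
      then obtain p where "F = homog d p" by (rule sym_powerE)
      then show "F \<in> X" unfolding homog_monomial
        using mX by (auto intro!: fs.subspace_sum[OF sub] fs.subspace_scale[OF sub])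
    qed
    then show ?thesis using X(1) by blast
  qed
  have "monomial d 0 (covec 1 0) \<noteq> 0" by (simp add: monomial_apply)
  then have "monomial d 0 \<noteq> 0" by auto
  then have "sym_power s d \<noteq> {0}" using monomial_in[of 0 d] by auto
  then show ?thesis
    unfolding irreducible_rep_def using full subrep_sym_power by blast
qed

text \<open>The span of the d-th powers is stable under SL(U) and nonzero, so irreducibility makes
  it everything. Linear assertions about forms may therefore be checked on powers.\<close>

lemma span_powers: "fs.span {sym_prod s (replicate d u) |u. True} = sym_power s d"
proof -
  let ?S = "{sym_prod s (replicate d u) |u. True}"
  let ?X = "fs.span ?S"
  have sub: "?X \<subseteq> sym_power s d"
    by (rule fs.span_minimal) (auto intro: sym_prod_in_sym_power sym_power_subspace)
  have "sym_map s g F \<in> ?X" if "g \<in> SL s" "F \<in> ?X" for g F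
  proof -
    interpret m: Vector_Spaces.linear fscale fscale "sym_map s g"
      by (rule linear_sym_map)
    have "sym_map s g ` ?S \<subseteq> ?S"
      using sym_map_sym_prod[OF SL_linear[OF that(1)]] by auto
    then have "fs.span (sym_map s g ` ?S) \<subseteq> ?X" by (rule fs.span_mono)
    then show ?thesis using that(2) by (auto simp: m.span_image)
  qed
  then have "subrep fscale (SL s) (sym_map s) ?X"
    unfolding subrep_def by simp
  moreover have "?X \<noteq> {0}"
  proof
    assume "?X = {0}"
    then have "sym_prod s (replicate d u0) = 0" using fs.span_base[of _ ?S] by blast
    then have "sym_prod s (replicate d u0) (covec 1 0) = 0" by simp
    then show False by (simp add: sym_prod_def)
  qed
  ultimately show ?thesis
    using sym_power_irreducible sub unfolding irreducible_rep_def by blast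
qed

end

section \<open>The exterior square as antisymmetric bihomogeneous forms\<close>

lemma wedge_lincomb_left:
  "wedge s (s c x + y) w = fscale c (wedge s x w) + wedge s y w"
  by (auto simp: wedge_def fun_eq_iff dual_add dual_scale algebra_simps)

lemma wedge_antisym: "wedge s v w = fscale (- 1) (wedge s w v)"
  by (auto simp: wedge_def fun_eq_iff)

lemma wedge_zero: "wedge s v v = 0"
  by (auto simp: wedge_def fun_eq_iff)

lemma wedge_lincomb_right:
  "wedge s w (s c x + y) = fscale c (wedge s w x) + wedge s w y"
  by (auto simp: wedge_def fun_eq_iff dual_add dual_scale algebra_simps)

lemma dual_0: "vector_space s \<Longrightarrow> \<phi> \<in> dual s \<Longrightarrow> \<phi> 0 = 0"
  using dual_add[of \<phi> s 0 0] by simp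

lemma wedge_0_left: "vector_space s \<Longrightarrow> wedge s 0 w = 0"
  by (auto simp: wedge_def fun_eq_iff dual_0)

lemma ext_square_subspace: "fs.subspace (ext_square s A)"
  by (simp add: ext_square_def)

lemma wedge_in_ext_square: "v \<in> A \<Longrightarrow> w \<in> A \<Longrightarrow> wedge s v w \<in> ext_square s A"
  unfolding ext_square_def by (auto intro: fs.span_base)

lemma wedge_span:
  assumes "vector_space s" "v \<in> module.span s B" "w \<in> module.span s B"
  shows "wedge s v w \<in> fs.span {wedge s x y |x y. x \<in> B \<and> y \<in> B}"
proof -
  interpret s: vector_space s by (rule assms(1))
  let ?S = "fs.span {wedge s x y |x y. x \<in> B \<and> y \<in> B}"
  have *: "wedge s x w \<in> ?S" if "x \<in> B" for x
    using assms(3)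
  proof (induction rule: s.span_induct_alt)
    case base
    have "wedge s x 0 = 0"
      by (auto simp: wedge_def fun_eq_iff dual_0[OF assms(1)])
    then show ?case by (simp only: fs.span_zero)
  next
    case (step c a b)
    then have "wedge s x a \<in> ?S" using that by (auto intro: fs.span_base)
    then show ?case unfolding wedge_lincomb_right
      by (intro fs.span_add fs.span_scale step(2))
  qed
  show ?thesis
    using assms(2)
  proof (induction rule: s.span_induct_alt)
    case base
    show ?case by (simp only: fs.span_zero wedge_0_left[OF assms(1)])
  next
    case (step c a b)
    then show ?case unfolding wedge_lincomb_left
      by (intro fs.span_add fs.span_scale step(2) *)
  qed
qed

lemma ext_square_outside:
  "F \<in> ext_square s A \<Longrightarrow> \<not> (\<phi> \<in> dual s \<and> \<psi> \<in> dual s) \<Longrightarrow> F (\<phi>, \<psi>) = 0"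
  unfolding ext_square_def
  by (induction rule: fs.span_induct_alt) (auto simp: wedge_def)

lemma ext_square_antisym: "F \<in> ext_square s A \<Longrightarrow> F (\<phi>, \<psi>) = - F (\<psi>, \<phi>)"
  unfolding ext_square_def
  by (induction rule: fs.span_induct_alt) (auto simp: wedge_def algebra_simps)

text \<open>Contraction of a bivector with a functional is a vector: for \<open>wedge s v w\<close>
  it is \<open>\<psi> w\<close> times \<open>v\<close> minus \<open>\<psi> v\<close> times
  \<open>w\<close>. In the second argument \<open>\<psi>\<close> the form thus collapses to an
  element of \<open>A\<close>.\<close>

lemma ext_square_contract:
  assumes "vector_space s" "module.subspace s A" "F \<in> ext_square s A" "\<psi> \<in> dual s"
  shows "\<exists>w\<in>A. \<forall>\<phi>\<in>dual s. F (\<phi>, \<psi>) = \<phi> w"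
proof -
  interpret s: vector_space s by (rule assms(1))
  show ?thesis
    using assms(3) unfolding ext_square_def
  proof (induction rule: fs.span_induct_alt)
    case base
    show ?case using s.subspace_0[OF assms(2)] dual_0[OF assms(1)] by (auto intro!: bexI[of _ 0])
  next
    case (step c F G)
    then obtain v w x where vw: "F = wedge s v w" "v \<in> A" "w \<in> A"
      and x: "x \<in> A" "\<forall>\<phi>\<in>dual s. G (\<phi>, \<psi>) = \<phi> x"
      by blast
    let ?y = "s (c * \<psi> w) v + (s (- c * \<psi> v) w + x)"
    have "?y \<in> A"
      using vw x assms(2) by (intro s.subspace_add s.subspace_scale)
    moreover have "(fscale c F + G) (\<phi>, \<psi>) = \<phi> ?y" if "\<phi> \<in> dual s" for \<phi>
      unfolding dual_add[OF that] dual_scale[OF that]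
      using that x vw(1) assms(4) by (simp add: wedge_def algebra_simps)
    ultimately show ?case by blast
  qed
qed

section \<open>Evaluation of bivectors at pairs of points\<close>

definition eval_pair :: "((('x \<Rightarrow> complex) \<Rightarrow> complex) \<times> (('x \<Rightarrow> complex) \<Rightarrow> complex) \<Rightarrow> complex) \<Rightarrow> 'x \<times> 'x \<Rightarrow> complex" where
  "eval_pair F = (\<lambda>(\<phi>, \<psi>). F (\<lambda>f. f \<phi>, \<lambda>f. f \<psi>))"

lemma eval_pair_add: "eval_pair (F + G) = eval_pair F + eval_pair G"
  and eval_pair_scale: "eval_pair (fscale c F) = fscale c (eval_pair F)"
  and eval_pair_zero: "eval_pair 0 = 0"
  by (auto simp: eval_pair_def fun_eq_iff)

lemma eval_pair_wedge: "eval_pair (wedge fscale v w) (\<phi>, \<psi>) = v \<phi> * w \<psi> - w \<phi> * v \<psi>"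
  by (simp add: eval_pair_def wedge_def ev_dual)

text \<open>With the second functional fixed, \<open>F\<close> is pairing with a function
  \<open>w\<close>; if all point evaluations of \<open>w\<close> vanish, then \<open>w = 0\<close>,
  and so the arbitrary first functional gives 0 as well. This is used once with a point in the
  second slot, then, after exchanging the slots by antisymmetry, with an arbitrary functional
  there.\<close>

lemma ext_square_eq_0:
  assumes A: "fs.subspace A" and F: "F \<in> ext_square fscale A" and ev: "eval_pair F = 0"
  shows "F = 0"
proof -
  have *: "F (\<Phi>, \<Psi>) = 0"
    if d: "\<Phi> \<in> dual fscale" "\<Psi> \<in> dual fscale" "\<And>\<phi>. F (\<lambda>f. f \<phi>, \<Psi>) = 0" for \<Phi> \<Psi>
  proof -
    obtain w where w: "\<forall>\<Phi>\<in>dual fscale. F (\<Phi>, \<Psi>) = \<Phi> w"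
      using ext_square_contract[OF vector_space_fscale A F d(2)] by blast
    have "w \<phi> = 0" for \<phi>
      using bspec[OF w ev_dual, of \<phi>] d(3)[of \<phi>] by simp
    then have "w = 0" by (simp add: fun_eq_iff)
    then show ?thesis using bspec[OF w d(1)] dual_0[OF vector_space_fscale d(1)] by metis
  qed
  have 1: "F (\<lambda>f. f \<phi>, \<lambda>f. f \<psi>) = 0" for \<phi> \<psi>
    using fun_cong[OF ev, of "(\<phi>, \<psi>)"] by (simp add: eval_pair_def)
  have "F (\<Phi>, \<lambda>f. f \<psi>) = 0" if "\<Phi> \<in> dual fscale" for \<Phi> \<psi>
    by (rule *[OF that ev_dual 1])
  then have 2: "F (\<lambda>f. f \<psi>, \<Phi>) = 0" if "\<Phi> \<in> dual fscale" for \<Phi> \<psi>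
    using that ext_square_antisym[OF F, of "\<lambda>f. f \<psi>" \<Phi>] by simp
  have "F (\<Phi>, \<Psi>) = 0" if "\<Phi> \<in> dual fscale" "\<Psi> \<in> dual fscale" for \<Phi> \<Psi>
    by (rule *[OF that 2[OF that(2)]])
  then have "F (\<Phi>, \<Psi>) = 0" for \<Phi> \<Psi>
    using ext_square_outside[OF F] by blast
  then show ?thesis by (simp add: fun_eq_iff)
qed

lemma eval_pair_inj:
  assumes "fs.subspace A" "F \<in> ext_square fscale A" "G \<in> ext_square fscale A" "eval_pair F = eval_pair G"
  shows "F = G"
proof -
  have "eval_pair (F - G) = eval_pair F - eval_pair G" by (auto simp: eval_pair_def fun_eq_iff)
  then have "eval_pair (F - G) = 0" using assms(4) by simp
  then have "F - G = 0"
    by (rule ext_square_eq_0[OF assms(1) fs.subspace_diff[OF ext_square_subspace assms(2,3)]])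
  then show ?thesis by (rule eq_iff_diff_eq_0[THEN iffD2])
qed

lemma linear_ext_map: "Vector_Spaces.linear fscale fscale (ext_map s A)"
  unfolding Vector_Spaces.linear_iff
  by (auto simp: vector_space_fscale ext_map_def fun_eq_iff)

lemma ext_map_ext_square:
  assumes "Vector_Spaces.linear s s A" "\<And>v. v \<in> S \<Longrightarrow> A v \<in> S" "F \<in> ext_square s S"
  shows "ext_map s A F \<in> ext_square s S"
proof -
  interpret m: Vector_Spaces.linear fscale fscale "ext_map s A"
    by (rule linear_ext_map)
  let ?S = "{wedge s v w |v w. v \<in> S \<and> w \<in> S}"
  have "ext_map s A F \<in> ?S" if F: "F \<in> ?S" for F
  proof -
    obtain v w where "F = wedge s v w" "v \<in> S" "w \<in> S" using F by blast
    then have "ext_map s A F = wedge s (A v) (A w)" "A v \<in> S" "A w \<in> S"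
      using ext_map_wedge[OF assms(1)] assms(2) by auto
    then show ?thesis by blast
  qed
  then have "ext_map s A ` ?S \<subseteq> ?S" by (rule image_subsetI)
  then have "fs.span (ext_map s A ` ?S) \<subseteq> fs.span ?S" by (rule fs.span_mono)
  moreover have "ext_map s A F \<in> ext_map s A ` fs.span ?S"
    using assms(3) unfolding ext_square_def by (rule imageI)
  ultimately show ?thesis
    unfolding m.span_image ext_square_def by (rule subsetD)
qed

lemma subrep_ext_square:
  "subrep fscale (SL s) (\<lambda>g. ext_map fscale (sym_map s g)) (ext_square fscale (sym_power s n))"
  unfolding subrep_def
proof (intro conjI ballI)
  fix g F assume "g \<in> SL s" and F: "F \<in> ext_square fscale (sym_power s n)"
  then have "sym_map s g v \<in> sym_power s n" if "v \<in> sym_power s n" for v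
    using that by (intro sym_map_sym_power SL_linear)
  then show "ext_map fscale (sym_map s g) F \<in> ext_square fscale (sym_power s n)"
    by (rule ext_map_ext_square[OF linear_sym_map _ F])
qed (rule ext_square_subspace)

lemma eval_pair_ext_map:
  assumes "\<phi> \<in> dual s" "\<psi> \<in> dual s"
  shows "eval_pair (ext_map fscale (sym_map s g) F) (\<phi>, \<psi>) = eval_pair F (\<phi> \<circ> g, \<psi> \<circ> g)"
  using assms by (simp add: eval_pair_def ext_map_def ev_dual sym_map_def o_def)

context plane
begin

text \<open>By bilinearity and antisymmetry the wedges of monomials with exponents a < b \<le> n
  span, and there are 0 + 1 + ... + n such pairs.\<close>

lemma ext_square_le:
  obtains S where "finite S" "card S \<le> n * (n + 1) div 2" "ext_square fscale (sym_power s n) \<subseteq> fs.span S"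
proof -
  define f where "f = (\<lambda>(b, a). wedge fscale (monomial n a) (monomial n b))"
  define D where "D = Sigma {..n} (\<lambda>b. {..<b})"
  have fin: "finite D" by (auto simp: D_def)
  have "card D = n * (n + 1) div 2"
    unfolding D_def by (simp add: atMost_atLeast0 gauss_sum_nat)
  then have "card (f ` D) \<le> n * (n + 1) div 2"
    using card_image_le[OF fin, of f] by simp
  have M: "sym_power s n \<subseteq> fs.span (monomial n ` {..n})"
  proof
    fix F assume "F \<in> sym_power s n"
    then obtain p where "F = homog n p" by (rule sym_powerE)
    then show "F \<in> fs.span (monomial n ` {..n})"
      unfolding homog_monomial by (auto intro!: fs.span_sum intro: fs.span_scale fs.span_base)
  qed
  have g: "wedge fscale (monomial n a) (monomial n b) \<in> fs.span (f ` D)" if "a \<le> n" "b \<le> n" for a b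
  proof -
    consider "a < b" | "a = b" | "b < a" by linarith
    then show ?thesis
    proof cases
      case 1
      then have "(b, a) \<in> D" using that by (simp add: D_def)
      then have "f (b, a) \<in> fs.span (f ` D)" by (intro fs.span_base imageI)
      then show ?thesis by (simp add: f_def)
    next
      case 2
      then show ?thesis by (simp only: wedge_zero fs.span_zero)
    next
      case 3
      then have "(a, b) \<in> D" using that by (simp add: D_def)
      then have "f (a, b) \<in> fs.span (f ` D)" by (intro fs.span_base imageI)
      then have "wedge fscale (monomial n b) (monomial n a) \<in> fs.span (f ` D)" by (simp add: f_def)
      then show ?thesis
        unfolding wedge_antisym[of fscale "monomial n a" "monomial n b"] by (rule fs.span_scale)
    qed
  qed
  have "{wedge fscale x y |x y. x \<in> monomial n ` {..n} \<and> y \<in> monomial n ` {..n}} \<subseteq> fs.span (f ` D)"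
    using g by auto
  then have "fs.span {wedge fscale x y |x y. x \<in> monomial n ` {..n} \<and> y \<in> monomial n ` {..n}} \<subseteq> fs.span (f ` D)"
    by (rule fs.span_minimal) simp
  then have "wedge fscale v w \<in> fs.span (f ` D)" if "v \<in> sym_power s n" "w \<in> sym_power s n" for v w
    using wedge_span[OF vector_space_fscale] M that by blast
  then have "ext_square fscale (sym_power s n) \<subseteq> fs.span (f ` D)"
    unfolding ext_square_def by (intro fs.span_minimal) auto
  then show ?thesis using that fin \<open>card (f ` D) \<le> _\<close> by blast
qed

section \<open>Bihomogeneous forms\<close>

definition tensor :: "('x \<Rightarrow> complex) \<Rightarrow> ('x \<Rightarrow> complex) \<Rightarrow> 'x \<times> 'x \<Rightarrow> complex" where
  "tensor v w = (\<lambda>(\<phi>, \<psi>). v \<phi> * w \<psi>)"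

definition bihom :: "nat \<Rightarrow> (('u \<Rightarrow> complex) \<times> ('u \<Rightarrow> complex) \<Rightarrow> complex) set" where
  "bihom k = fs.span {tensor v w |v w. v \<in> sym_power s k \<and> w \<in> sym_power s k}"

lemma bihom_subspace: "fs.subspace (bihom k)"
  by (simp add: bihom_def)

lemma tensor_in_bihom: "v \<in> sym_power s k \<Longrightarrow> w \<in> sym_power s k \<Longrightarrow> tensor v w \<in> bihom k"
  unfolding bihom_def by (auto intro: fs.span_base)

lemma bihom_mult:
  assumes "P \<in> bihom a" "Q \<in> bihom b"
  shows "P * Q \<in> bihom (a + b)"
proof -
  have *: "tensor v w * Q \<in> bihom (a + b)" if vw: "v \<in> sym_power s a" "w \<in> sym_power s a" for v w
    using assms(2) unfolding bihom_def[of b]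
  proof (induction rule: fs.span_induct_alt)
    case base
    have "tensor v w * 0 = 0" by (simp add: fun_eq_iff)
    then show ?case by (simp only: fs.subspace_0[OF bihom_subspace])
  next
    case (step c x y)
    from step(1) obtain v' w' where x: "x = tensor v' w'" "v' \<in> sym_power s b" "w' \<in> sym_power s b"
      by blast
    have "tensor v w * x = tensor (v * v') (w * w')"
      by (auto simp: x tensor_def fun_eq_iff)
    then have "tensor v w * x \<in> bihom (a + b)"
      using vw x by (auto intro: tensor_in_bihom sym_power_mult)
    moreover have "tensor v w * (fscale c x + y) = fscale c (tensor v w * x) + tensor v w * y"
      by (auto simp: fun_eq_iff algebra_simps)
    ultimately show ?case
      by (simp only: fs.subspace_add[OF bihom_subspace] fs.subspace_scale[OF bihom_subspace] step(2))
  qed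
  show ?thesis
    using assms(1) unfolding bihom_def[of a]
  proof (induction rule: fs.span_induct_alt)
    case base
    have "0 * Q = 0" by (simp add: fun_eq_iff)
    then show ?case by (simp only: fs.subspace_0[OF bihom_subspace])
  next
    case (step c x y)
    then have "x * Q \<in> bihom (a + b)" using * by auto
    moreover have "(fscale c x + y) * Q = fscale c (x * Q) + y * Q"
      by (auto simp: fun_eq_iff algebra_simps)
    ultimately show ?case
      by (simp only: fs.subspace_add[OF bihom_subspace] fs.subspace_scale[OF bihom_subspace] step(2))
  qed
qed

text \<open>Replacing each tensor of \<open>v\<close> and \<open>w\<close> by the wedge of
  \<open>v\<close> and \<open>w\<close> yields a bivector with values P(\<phi>,\<psi>) -
  P(\<psi>,\<phi>). For antisymmetric \<open>P\<close> this is 2P, whence the factor 1/2.\<close>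

lemma bihom_antisym:
  assumes P: "P \<in> bihom k" and anti: "\<And>\<phi> \<psi>. P (\<phi>, \<psi>) = - P (\<psi>, \<phi>)"
  obtains F where "F \<in> ext_square fscale (sym_power s k)" "eval_pair F = P"
proof -
  have "\<exists>F\<in>ext_square fscale (sym_power s k). \<forall>\<phi> \<psi>. eval_pair F (\<phi>, \<psi>) = P (\<phi>, \<psi>) - P (\<psi>, \<phi>)"
    using P unfolding bihom_def
  proof (induction rule: fs.span_induct_alt)
    case base
    have "eval_pair 0 (\<phi>, \<psi>) = 0 (\<phi>, \<psi>) - 0 (\<psi>, \<phi>)" for \<phi> \<psi> :: "'u \<Rightarrow> complex"
      unfolding eval_pair_zero by simp
    then show ?case
      using fs.subspace_0[OF ext_square_subspace] by blast
  next
    case (step c x y)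
    then obtain v w F where x: "x = tensor v w" "v \<in> sym_power s k" "w \<in> sym_power s k"
      and F: "F \<in> ext_square fscale (sym_power s k)" "\<And>\<phi> \<psi>. eval_pair F (\<phi>, \<psi>) = y (\<phi>, \<psi>) - y (\<psi>, \<phi>)"
      by blast
    have "fscale c (wedge fscale v w) + F \<in> ext_square fscale (sym_power s k)"
      using x F by (intro fs.subspace_add fs.subspace_scale ext_square_subspace wedge_in_ext_square)
    moreover have "eval_pair (fscale c (wedge fscale v w) + F) (\<phi>, \<psi>) =
        (fscale c x + y) (\<phi>, \<psi>) - (fscale c x + y) (\<psi>, \<phi>)" for \<phi> \<psi>
      by (simp add: eval_pair_add eval_pair_scale eval_pair_wedge F x(1) tensor_def algebra_simps)
    ultimately show ?case by blast
  qed
  then obtain F where F: "F \<in> ext_square fscale (sym_power s k)"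
    "\<And>\<phi> \<psi>. eval_pair F (\<phi>, \<psi>) = P (\<phi>, \<psi>) - P (\<psi>, \<phi>)"
    by blast
  have "eval_pair (fscale (1/2) F) (\<phi>, \<psi>) = P (\<phi>, \<psi>)" for \<phi> \<psi>
    using F(2)[of \<phi> \<psi>] anti[of \<psi> \<phi>] by (simp add: eval_pair_scale)
  then have "eval_pair (fscale (1/2) F) = P" by (auto simp: fun_eq_iff)
  then show ?thesis
    by (rule that[OF fs.subspace_scale[OF ext_square_subspace F(1)]])
qed

text \<open>With one argument fixed, divisibility by powers of the bracket becomes a matter of
  polynomials in one variable.\<close>

lemma bihom_poly:
  assumes "P \<in> bihom k"
  obtains q where "\<And>z. P (\<phi>, covec 1 z) = poly q z"
proof -
  have "\<exists>q. \<forall>z. P (\<phi>, covec 1 z) = poly q z"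
    using assms unfolding bihom_def
  proof (induction rule: fs.span_induct_alt)
    case base
    show ?case by (intro exI[of _ 0]) simp
  next
    case (step c x y)
    then obtain v w q where x: "x = tensor v w" "w \<in> sym_power s k"
      and q: "\<And>z. y (\<phi>, covec 1 z) = poly q z"
      by blast
    obtain p where "\<And>z. w (covec 1 z) = poly p z"
      by (rule sym_power_poly[OF x(2)], rule that)
    then show ?case
      by (intro exI[of _ "smult (c * v \<phi>) p + q"]) (simp add: x(1) tensor_def q)
  qed
  then show ?thesis using that by blast
qed

definition bracket_pow :: "nat \<Rightarrow> ('u \<Rightarrow> complex) \<times> ('u \<Rightarrow> complex) \<Rightarrow> complex" where
  "bracket_pow k = (\<lambda>(\<phi>, \<psi>). if \<phi> \<in> dual s \<and> \<psi> \<in> dual s then bracket \<phi> \<psi> ^ k else 0)"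

lemma bracket_pow_bihom: "bracket_pow k \<in> bihom k"
proof (induction k)
  case 0
  have "bracket_pow 0 = tensor (monomial 0 0) (monomial 0 0)"
    by (auto simp: bracket_pow_def tensor_def fun_eq_iff monomial_apply)
  then show ?case by (simp add: tensor_in_bihom monomial_in)
next
  case (Suc k)
  have "bracket_pow 1 = tensor (monomial 1 0) (monomial 1 1) - tensor (monomial 1 1) (monomial 1 0)"
    by (auto simp: bracket_pow_def bracket_def tensor_def fun_eq_iff monomial_apply)
  moreover have "tensor (monomial 1 0) (monomial 1 1) - tensor (monomial 1 1) (monomial 1 0) \<in> bihom 1"
    by (intro fs.subspace_diff bihom_subspace tensor_in_bihom monomial_in) auto
  ultimately have "bracket_pow 1 * bracket_pow k \<in> bihom (1 + k)"
    by (simp only: bihom_mult[OF _ Suc])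
  moreover have "bracket_pow (Suc k) = bracket_pow 1 * bracket_pow k"
    by (auto simp: bracket_pow_def fun_eq_iff)
  ultimately show ?case by (simp only: plus_1_eq_Suc)
qed

end

section \<open>Polarization\<close>

text \<open>The symmetry \<open>\<omega> k ^ j = \<omega> j ^ k\<close> turns the sum into a
  geometric series in \<open>\<omega> i / \<omega> m\<close>, an N-th root of unity that differs
  from 1 when i and m do.\<close>

lemma roots_of_unity_orthogonality:
  fixes N i m :: nat
  assumes "i < N" "m < N"
  defines "\<omega> \<equiv> \<lambda>k. cis (2 * pi * real k / real N)"
  shows "(\<Sum>k<N. \<omega> k ^ i / \<omega> k ^ m) = (if i = m then of_nat N else 0)"
proof (cases "i = m")
  case True
  then show ?thesis by (simp add: \<omega>_def)
next
  case False
  define \<zeta> where "\<zeta> = \<omega> i / \<omega> m"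
  have bij: "bij_betw \<omega> {..<N} {z. z ^ N = 1}"
    unfolding \<omega>_def using assms by (intro bij_betw_roots_unity) auto
  have "\<omega> i \<noteq> \<omega> m"
    using bij False assms(1,2) by (auto simp: bij_betw_def inj_on_def)
  moreover have "\<omega> m \<noteq> 0" by (simp add: \<omega>_def)
  ultimately have "\<zeta> \<noteq> 1" by (simp add: \<zeta>_def)
  have "\<omega> i ^ N = 1" "\<omega> m ^ N = 1"
    using bij assms(1,2) by (auto simp: bij_betw_def)
  then have "\<zeta> ^ N = 1" by (simp add: \<zeta>_def power_divide)
  have comm: "\<omega> k ^ j = \<omega> j ^ k" for k j
    by (simp add: \<omega>_def DeMoivre algebra_simps)
  have "(\<Sum>k<N. \<omega> k ^ i / \<omega> k ^ m) = (\<Sum>k<N. \<zeta> ^ k)"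
    by (simp add: \<zeta>_def power_divide comm)
  also have "\<dots> = 0"
    using \<open>\<zeta> \<noteq> 1\<close> \<open>\<zeta> ^ N = 1\<close> by (simp add: geometric_sum)
  finally show ?thesis using False by simp
qed

lemma eval_pair_outside:
  assumes "F \<in> ext_square fscale (sym_power s n)" "\<not> (\<phi> \<in> dual s \<and> \<psi> \<in> dual s)"
  shows "eval_pair F (\<phi>, \<psi>) = 0"
  using assms(1) unfolding ext_square_def
proof (induction rule: fs.span_induct_alt)
  case base
  show ?case unfolding eval_pair_zero by simp
next
  case (step c x y)
  then show ?case
  proof -
    from step(1) obtain v w where x: "x = wedge fscale v w" "v \<in> sym_power s n" "w \<in> sym_power s n"
      by blast
    then have "eval_pair x (\<phi>, \<psi>) = 0"
      unfolding x(1) eval_pair_wedge using assms(2) sym_power_outside[OF x(2)] sym_power_outside[OF x(3)] by auto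
    then show ?thesis
      unfolding eval_pair_add eval_pair_scale using step(2) by simp
  qed
qed

context plane
begin

text \<open>Polarization: for \<open>h\<close> homogeneous of degree \<open>2m\<close> this is the coefficient of \<open>t ^ m\<close> in
  \<open>h (\<phi> + t \<psi>)\<close>, extracted by averaging over the roots of unity of order \<open>2m + 1\<close>.\<close>

definition polarize :: "nat \<Rightarrow> (('u \<Rightarrow> complex) \<Rightarrow> complex) \<Rightarrow> ('u \<Rightarrow> complex) \<times> ('u \<Rightarrow> complex) \<Rightarrow> complex" where
  "polarize m h = (\<lambda>(\<phi>, \<psi>). if \<phi> \<in> dual s \<and> \<psi> \<in> dual s then
     (\<Sum>k\<le>2 * m. let \<omega> = cis (2 * pi * real k / real (2 * m + 1))
        in h (\<lambda>u. \<phi> u + \<omega> * \<psi> u) / \<omega> ^ m) / of_nat (2 * m + 1) else 0)"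

lemma linear_polarize: "Vector_Spaces.linear fscale fscale (polarize m)"
  unfolding Vector_Spaces.linear_iff
  by (auto simp: vector_space_fscale polarize_def fun_eq_iff Let_def sum.distrib add_divide_distrib
      sum_distrib_left[symmetric] simp flip: times_divide_eq_right)

text \<open>The formula evaluates \<open>h\<close> only at the covectors \<phi> + \<omega>\<psi>,
  and composition with \<open>g\<close> commutes with forming them.\<close>

lemma polarize_sym_map:
  assumes "g \<in> SL s" "\<phi> \<in> dual s" "\<psi> \<in> dual s"
  shows "polarize m (sym_map s g h) (\<phi>, \<psi>) = polarize m h (\<phi> \<circ> g, \<psi> \<circ> g)"
proof -
  have "sym_map s g h (\<lambda>u. \<phi> u + c * \<psi> u) = h (\<lambda>u. (\<phi> \<circ> g) u + c * (\<psi> \<circ> g) u)" for c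
    using dual_lincomb[OF vector_space_axioms assms(2,3), of c] by (simp add: sym_map_def o_def)
  then show ?thesis
    using assms SL_dual[OF assms(1)] by (simp add: polarize_def)
qed

lemma polarize_power:
  "polarize m (sym_prod s (replicate (2 * m) u)) =
   fscale (of_nat ((2 * m) choose m)) (tensor (sym_prod s (replicate m u)) (sym_prod s (replicate m u)))"
proof -
  let ?N = "2 * m + 1"
  let ?w = "\<lambda>k. cis (2 * pi * real k / real ?N)"
  have atMost: "{..2 * m} = {..<?N}" by auto
  \<comment> \<open>Expand binomially and exchange the sums; averaging over the roots of unity keeps
    only the exponent i = m, because all exponents lie below the order 2m + 1.\<close>
  have main: "(\<Sum>k\<le>2 * m. (x + ?w k * y) ^ (2 * m) / ?w k ^ m) = of_nat ?N * of_nat ((2 * m) choose m) * (x ^ m * y ^ m)"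
    for x y :: complex
  proof -
    have "(\<Sum>k\<le>2 * m. (x + ?w k * y) ^ (2 * m) / ?w k ^ m) =
        (\<Sum>k\<le>2 * m. \<Sum>i\<le>2 * m. of_nat ((2 * m) choose i) * y ^ i * x ^ (2 * m - i) * (?w k ^ i / ?w k ^ m))"
      by (subst add.commute) (simp add: binomial_ring sum_divide_distrib power_mult_distrib mult_ac)
    also have "\<dots> = (\<Sum>i\<le>2 * m. \<Sum>k\<le>2 * m. of_nat ((2 * m) choose i) * y ^ i * x ^ (2 * m - i) * (?w k ^ i / ?w k ^ m))"
      by (rule sum.swap)
    also have "\<dots> = (\<Sum>i\<le>2 * m. of_nat ((2 * m) choose i) * y ^ i * x ^ (2 * m - i) * (if i = m then of_nat ?N else 0))"
    proof (rule sum.cong[OF refl])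
      fix i assume "i \<in> {..2 * m}"
      then have "(\<Sum>k\<le>2 * m. ?w k ^ i / ?w k ^ m) = (if i = m then of_nat ?N else 0)"
        unfolding atMost by (intro roots_of_unity_orthogonality) auto
      then show "(\<Sum>k\<le>2 * m. of_nat ((2 * m) choose i) * y ^ i * x ^ (2 * m - i) * (?w k ^ i / ?w k ^ m)) =
          of_nat ((2 * m) choose i) * y ^ i * x ^ (2 * m - i) * (if i = m then of_nat ?N else 0)"
        by (simp only: sum_distrib_left[symmetric])
    qed
    also have "\<dots> = (\<Sum>i\<le>2 * m. if i = m then of_nat ((2 * m) choose i) * y ^ i * x ^ (2 * m - i) * of_nat ?N else 0)"
      by (rule sum.cong) auto
    also have "\<dots> = of_nat ?N * of_nat ((2 * m) choose m) * (x ^ m * y ^ m)"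
      by (subst sum.delta) (auto simp: mult_ac)
    finally show ?thesis .
  qed
  have "polarize m (sym_prod s (replicate (2 * m) u)) (\<phi>, \<psi>) =
      of_nat ((2 * m) choose m) * (\<phi> u ^ m * \<psi> u ^ m)" if d: "\<phi> \<in> dual s" "\<psi> \<in> dual s" for \<phi> \<psi>
  proof -
    have "polarize m (sym_prod s (replicate (2 * m) u)) (\<phi>, \<psi>) =
        (\<Sum>k\<le>2 * m. (\<phi> u + ?w k * \<psi> u) ^ (2 * m) / ?w k ^ m) / of_nat ?N"
      using d dual_lincomb[OF vector_space_axioms d] by (simp add: polarize_def sym_prod_def Let_def)
    also have "\<dots> = of_nat ((2 * m) choose m) * (\<phi> u ^ m * \<psi> u ^ m)"
    proof -
      have "of_nat ?N \<noteq> (0 :: complex)" by (simp only: of_nat_eq_0_iff)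
      then show ?thesis unfolding main by (simp only: mult.assoc nonzero_mult_div_cancel_left not_False_eq_True)
    qed
    finally show ?thesis .
  qed
  moreover have "polarize m h (\<phi>, \<psi>) = 0" if "\<not> (\<phi> \<in> dual s \<and> \<psi> \<in> dual s)" for h \<phi> \<psi>
    unfolding polarize_def prod.case if_not_P[OF that] ..
  ultimately show ?thesis
    by (auto simp: fun_eq_iff tensor_def sym_prod_def)
qed

text \<open>All three properties are linear in \<open>h\<close>, and on a power of \<open>u\<close>
  the polarization is a binomial multiple of the tensor square of \<open>u ^ m\<close>, where they
  can be read off.\<close>

lemma polarize_props:
  assumes "h \<in> sym_power s (2 * m)"
  shows "polarize m h \<in> bihom m" "polarize m h (\<phi>, \<psi>) = polarize m h (\<psi>, \<phi>)"
    "polarize m h (\<phi>, \<phi>) = of_nat ((2 * m) choose m) * h \<phi>"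
proof -
  interpret m: Vector_Spaces.linear fscale fscale "polarize m"
    by (rule linear_polarize)
  have "polarize m h \<in> bihom m \<and> (\<forall>\<phi> \<psi>. polarize m h (\<phi>, \<psi>) = polarize m h (\<psi>, \<phi>)) \<and>
    (\<forall>\<phi>. polarize m h (\<phi>, \<phi>) = of_nat ((2 * m) choose m) * h \<phi>)"
    using assms unfolding span_powers[symmetric]
  proof (induction rule: fs.span_induct_alt)
    case base
    show ?case
    proof (intro conjI allI)
      show "polarize m 0 \<in> bihom m"
        unfolding m.zero by (rule fs.subspace_0[OF bihom_subspace])
    qed (unfold m.zero, simp_all)
  next
    case (step c x y)
    then obtain u where u: "x = sym_prod s (replicate (2 * m) u)" by blast
    have b: "polarize m x \<in> bihom m"
      unfolding u polarize_power
      by (intro fs.subspace_scale bihom_subspace tensor_in_bihom sym_prod_in_sym_power) simp_all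
    have sw: "polarize m x (\<phi>, \<psi>) = polarize m x (\<psi>, \<phi>)" for \<phi> \<psi>
      unfolding u polarize_power by (simp add: tensor_def)
    have di: "polarize m x (\<phi>, \<phi>) = of_nat ((2 * m) choose m) * x \<phi>" for \<phi>
      unfolding u polarize_power by (simp add: tensor_def sym_prod_def power_add[symmetric] mult_2)
    from step(2) have y: "polarize m y \<in> bihom m" "polarize m y (\<phi>, \<psi>) = polarize m y (\<psi>, \<phi>)"
      "polarize m y (\<phi>, \<phi>) = of_nat ((2 * m) choose m) * y \<phi>" for \<phi> \<psi>
      by blast+
    show ?case
      unfolding m.add m.scale
    proof (intro conjI allI)
      show "fscale c (polarize m x) + polarize m y \<in> bihom m"
        by (intro fs.subspace_add fs.subspace_scale bihom_subspace b y)
      show "(fscale c (polarize m x) + polarize m y) (\<phi>, \<psi>) = (fscale c (polarize m x) + polarize m y) (\<psi>, \<phi>)" for \<phi> \<psi>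
        using sw[of \<phi> \<psi>] y(2)[of \<phi> \<psi>] by simp
      show "(fscale c (polarize m x) + polarize m y) (\<phi>, \<phi>) = of_nat ((2 * m) choose m) * (fscale c x + y) \<phi>" for \<phi>
        by (simp add: di y(3) algebra_simps)
    qed
  qed
  then show "polarize m h \<in> bihom m" "polarize m h (\<phi>, \<psi>) = polarize m h (\<psi>, \<phi>)"
    "polarize m h (\<phi>, \<phi>) = of_nat ((2 * m) choose m) * h \<phi>" by blast+
qed

section \<open>The equivariant embeddings\<close>

lemma bracket_pow_anti: "odd k \<Longrightarrow> bracket_pow k (\<phi>, \<psi>) = - bracket_pow k (\<psi>, \<phi>)"
proof -
  assume "odd k"
  moreover have "bracket \<phi> \<psi> = - bracket \<psi> \<phi>" by (simp add: bracket_def)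
  ultimately show ?thesis by (simp add: bracket_pow_def power_minus_odd)
qed

text \<open>The choice is harmless: a bivector is determined by its values at pairs of points.
  Keeping \<open>j\<close> and \<open>m\<close> independent, with m + 2j + 1 in place of n, keeps
  truncated subtraction out of the construction.\<close>

definition embed :: "nat \<Rightarrow> nat \<Rightarrow> (('u \<Rightarrow> complex) \<Rightarrow> complex) \<Rightarrow>
    ((('u \<Rightarrow> complex) \<Rightarrow> complex) \<Rightarrow> complex) \<times> ((('u \<Rightarrow> complex) \<Rightarrow> complex) \<Rightarrow> complex) \<Rightarrow> complex" where
  "embed j m h = (SOME F. F \<in> ext_square fscale (sym_power s (m + (2 * j + 1))) \<and> eval_pair F = bracket_pow (2 * j + 1) * polarize m h)"

lemma embed:
  assumes "h \<in> sym_power s (2 * m)"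
  shows "embed j m h \<in> ext_square fscale (sym_power s (m + (2 * j + 1)))"
    "eval_pair (embed j m h) = bracket_pow (2 * j + 1) * polarize m h"
proof -
  let ?P = "bracket_pow (2 * j + 1) * polarize m h"
  have "?P \<in> bihom ((2 * j + 1) + m)"
    by (intro bihom_mult bracket_pow_bihom polarize_props assms)
  then have P: "?P \<in> bihom (m + (2 * j + 1))" by (simp only: add.commute)
  have anti: "?P (\<phi>, \<psi>) = - ?P (\<psi>, \<phi>)" for \<phi> \<psi>
    using polarize_props(2)[OF assms, of \<phi> \<psi>] bracket_pow_anti[of "2 * j + 1" \<phi> \<psi>] by simp
  have "\<exists>F. F \<in> ext_square fscale (sym_power s (m + (2 * j + 1))) \<and> eval_pair F = ?P"
    using bihom_antisym[OF P anti] by metis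
  then have "embed j m h \<in> ext_square fscale (sym_power s (m + (2 * j + 1))) \<and> eval_pair (embed j m h) = ?P"
    unfolding embed_def by (rule someI_ex)
  then show "embed j m h \<in> ext_square fscale (sym_power s (m + (2 * j + 1)))"
    "eval_pair (embed j m h) = ?P" by blast+
qed

text \<open>Reduces additivity, homogeneity and equivariance of \<open>embed\<close> to identities
  between functions on pairs of points.\<close>

lemma embed_eqI:
  assumes "h \<in> sym_power s (2 * m)" "F \<in> ext_square fscale (sym_power s (m + (2 * j + 1)))"
    "eval_pair F = bracket_pow (2 * j + 1) * polarize m h"
  shows "F = embed j m h"
  by (rule eval_pair_inj[OF sym_power_subspace assms(2) embed(1)[OF assms(1)]])
    (simp only: assms(3) embed(2)[OF assms(1)])

text \<open>On the chart the bracket of \<open>covec 1 z\<close> and \<open>covec 1 w\<close> is w -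
  z, which exhibits the order of vanishing at w = z. The cofactor there is a nonzero multiple of
  \<open>h\<close>, since the central binomial coefficient is nonzero.\<close>

lemma embed_poly:
  assumes "h \<in> sym_power s (2 * m)"
  obtains q where "\<And>w. eval_pair (embed j m h) (covec 1 z, covec 1 w) = (w - z) ^ (2 * j + 1) * poly q w"
    "poly q z = of_nat ((2 * m) choose m) * h (covec 1 z)"
proof -
  obtain q where q: "\<And>w. polarize m h (covec 1 z, covec 1 w) = poly q w"
    by (rule bihom_poly[OF polarize_props(1)[OF assms]], rule that)
  show ?thesis
  proof (rule that)
    show "eval_pair (embed j m h) (covec 1 z, covec 1 w) = (w - z) ^ (2 * j + 1) * poly q w" for w
      unfolding embed(2)[OF assms] times_fun_apply q by (simp add: bracket_pow_def bracket_def)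
    show "poly q z = of_nat ((2 * m) choose m) * h (covec 1 z)"
      using q[of z] polarize_props(3)[OF assms, of "covec 1 z"] by simp
  qed
qed

lemma embed_linear:
  assumes "h \<in> sym_power s (2 * m)" "k \<in> sym_power s (2 * m)"
  shows "embed j m (h + k) = embed j m h + embed j m k" "embed j m (fscale c h) = fscale c (embed j m h)"
proof -
  interpret m: Vector_Spaces.linear fscale fscale "polarize m"
    by (rule linear_polarize)
  have "embed j m h + embed j m k = embed j m (h + k)"
  proof (rule embed_eqI)
    show "h + k \<in> sym_power s (2 * m)"
      using assms fs.subspace_add[OF sym_power_subspace] by blast
    show "embed j m h + embed j m k \<in> ext_square fscale (sym_power s (m + (2 * j + 1)))"
      by (intro fs.subspace_add ext_square_subspace embed assms)
    show "eval_pair (embed j m h + embed j m k) = bracket_pow (2 * j + 1) * polarize m (h + k)"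
      unfolding eval_pair_add embed(2)[OF assms(1)] embed(2)[OF assms(2)] m.add
      by (simp add: fun_eq_iff algebra_simps)
  qed
  then show "embed j m (h + k) = embed j m h + embed j m k" ..
  have "fscale c (embed j m h) = embed j m (fscale c h)"
  proof (rule embed_eqI)
    show "fscale c h \<in> sym_power s (2 * m)"
      using assms(1) fs.subspace_scale[OF sym_power_subspace] by blast
    show "fscale c (embed j m h) \<in> ext_square fscale (sym_power s (m + (2 * j + 1)))"
      by (intro fs.subspace_scale ext_square_subspace embed assms)
    show "eval_pair (fscale c (embed j m h)) = bracket_pow (2 * j + 1) * polarize m (fscale c h)"
      unfolding eval_pair_scale embed(2)[OF assms(1)] m.scale
      by (simp add: fun_eq_iff algebra_simps)
  qed
  then show "embed j m (fscale c h) = fscale c (embed j m h)" ..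
qed

text \<open>At pairs of points the action is substitution of \<phi> \<circ> g and \<psi> \<circ> g;
  the bracket is unchanged by it, and polarization commutes with it.\<close>

lemma embed_equivariant:
  assumes g: "g \<in> SL s" and h: "h \<in> sym_power s (2 * m)"
  shows "embed j m (sym_map s g h) = ext_map fscale (sym_map s g) (embed j m h)"
proof -
  have "ext_map fscale (sym_map s g) (embed j m h) = embed j m (sym_map s g h)"
  proof (rule embed_eqI)
    show "sym_map s g h \<in> sym_power s (2 * m)"
      by (intro sym_map_sym_power SL_linear g h)
    show in_ext: "ext_map fscale (sym_map s g) (embed j m h) \<in> ext_square fscale (sym_power s (m + (2 * j + 1)))"
      using subrep_ext_square[of s "m + (2 * j + 1)"] g embed(1)[OF h] unfolding subrep_def by blast
    have "eval_pair (ext_map fscale (sym_map s g) (embed j m h)) (\<phi>, \<psi>) =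
        (bracket_pow (2 * j + 1) * polarize m (sym_map s g h)) (\<phi>, \<psi>)" for \<phi> \<psi>
    proof (cases "\<phi> \<in> dual s \<and> \<psi> \<in> dual s")
      case True
      then have d: "\<phi> \<in> dual s" "\<psi> \<in> dual s" by auto
      show ?thesis
        unfolding eval_pair_ext_map[OF d] embed(2)[OF h] times_fun_apply polarize_sym_map[OF g d]
        using SL_bracket[OF g d] SL_dual[OF g] d by (simp add: bracket_pow_def)
    next
      case False
      then have "eval_pair (ext_map fscale (sym_map s g) (embed j m h)) (\<phi>, \<psi>) = 0"
        by (rule eval_pair_outside[OF in_ext])
      moreover have "bracket_pow (2 * j + 1) (\<phi>, \<psi>) = 0" using False by (auto simp: bracket_pow_def)
      ultimately show ?thesis by simp
    qed
    then show "eval_pair (ext_map fscale (sym_map s g) (embed j m h)) = bracket_pow (2 * j + 1) * polarize m (sym_map s g h)"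
      by (auto simp: fun_eq_iff)
  qed
  then show ?thesis ..
qed

end

section \<open>The irreducible summands\<close>

text \<open>The set \<open>X\<close> is the projection of \<open>Y\<close> to \<open>A\<close> along
  \<open>W\<close>, a subrepresentation of the irreducible \<open>A\<close>. If it is zero, then
  \<open>Y\<close> lies in \<open>W\<close>.\<close>

lemma subrep_subset_complement:
  fixes s :: "complex \<Rightarrow> 'v::ab_group_add \<Rightarrow> 'v"
  assumes s: "vector_space s" and lin: "\<And>g. g \<in> G \<Longrightarrow> Vector_Spaces.linear s s (\<rho> g)"
    and A: "irreducible_rep s G \<rho> A" "vector_space.has_dim s A a"
    and W: "subrep s G \<rho> W" "vector_space.has_dim s W b" and AW: "A \<inter> W \<subseteq> {0}"
    and Y: "subrep s G \<rho> Y" "vector_space.has_dim s Y d" "d < a"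
    and YE: "Y \<subseteq> {x + y |x y. x \<in> A \<and> y \<in> W}"
  shows "Y \<subseteq> W"
proof -
  interpret s: vector_space s by (rule s)
  have sub: "s.subspace A" "s.subspace W" "s.subspace Y"
    and stab: "\<And>g x. g \<in> G \<Longrightarrow> x \<in> A \<Longrightarrow> \<rho> g x \<in> A" "\<And>g x. g \<in> G \<Longrightarrow> x \<in> W \<Longrightarrow> \<rho> g x \<in> W"
      "\<And>g x. g \<in> G \<Longrightarrow> x \<in> Y \<Longrightarrow> \<rho> g x \<in> Y"
    and irr: "\<And>X. X \<subseteq> A \<Longrightarrow> subrep s G \<rho> X \<Longrightarrow> X = {0} \<or> X = A"
    using A(1) W(1) Y(1) unfolding irreducible_rep_def subrep_def by blast+
  define X where "X = {x \<in> A. \<exists>y\<in>W. x + y \<in> Y}"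
  have "s.subspace X"
  proof (rule s.subspaceI)
    show "0 \<in> X"
      unfolding X_def using s.subspace_0[OF sub(1)] s.subspace_0[OF sub(2)] s.subspace_0[OF sub(3)]
      by (auto intro!: bexI[of _ 0])
    show "x + x' \<in> X" if xx: "x \<in> X" "x' \<in> X" for x x'
    proof -
      obtain y y' where "y \<in> W" "x + y \<in> Y" "y' \<in> W" "x' + y' \<in> Y" "x \<in> A" "x' \<in> A"
        using xx unfolding X_def by blast
      moreover from this have "(x + x') + (y + y') \<in> Y"
        using s.subspace_add[OF sub(3), of "x + y" "x' + y'"] by (simp add: algebra_simps)
      ultimately show ?thesis
        unfolding X_def using s.subspace_add[OF sub(1)] s.subspace_add[OF sub(2)] by blast
    qed
    show "s c x \<in> X" if x: "x \<in> X" for c x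
    proof -
      obtain y where "y \<in> W" "x + y \<in> Y" "x \<in> A" using x unfolding X_def by blast
      moreover from this have "s c x + s c y \<in> Y"
        using s.subspace_scale[OF sub(3), of "x + y" c] by (simp add: s.scale_right_distrib)
      ultimately show ?thesis
        unfolding X_def using s.subspace_scale[OF sub(1)] s.subspace_scale[OF sub(2)] by blast
    qed
  qed
  moreover have "\<rho> g x \<in> X" if gx: "g \<in> G" "x \<in> X" for g x
  proof -
    interpret g: Vector_Spaces.linear s s "\<rho> g" by (rule lin[OF gx(1)])
    obtain y where y: "y \<in> W" "x + y \<in> Y" "x \<in> A" using gx(2) unfolding X_def by blast
    then have "\<rho> g x + \<rho> g y \<in> Y" using stab(3)[OF gx(1) y(2)] by (simp add: g.add)
    then show ?thesis unfolding X_def using stab(1,2)[OF gx(1)] y by blast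
  qed
  ultimately have "subrep s G \<rho> X" unfolding subrep_def by blast
  then have "X = {0} \<or> X = A" by (intro irr) (auto simp: X_def)
  \<comment> \<open>Otherwise \<open>A \<subseteq> Y + W\<close>, so that \<open>A + W\<close> has dimension at most \<open>d + b\<close>.\<close>
  moreover have "X \<noteq> A"
  proof
    assume XA: "X = A"
    obtain B C where B: "finite B" "s.span B = Y" "card B = d" and C: "finite C" "s.span C = W" "card C = b"
      using Y(2) W(2) unfolding s.has_dim_def by metis
    have "{x + y |x y. x \<in> A \<and> y \<in> W} \<subseteq> s.span (B \<union> C)"
    proof clarify
      fix x w assume "x \<in> A" "w \<in> W"
      then obtain y where y: "y \<in> W" "x + y \<in> Y" using XA unfolding X_def by blast
      have "w - y \<in> W" using s.subspace_diff[OF sub(2) \<open>w \<in> W\<close> y(1)] .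
      moreover have "x + w = (x + y) + (w - y)" by simp
      ultimately show "x + w \<in> s.span (B \<union> C)"
        unfolding s.span_Un B(2) C(2) using y(2) by blast
    qed
    then have "a + b \<le> card (B \<union> C)"
      using s.has_dim_plus[OF A(2) W(2) AW] s.has_dim_le_card B(1) C(1) by blast
    also have "\<dots> \<le> d + b" using card_Un_le[of B C] B(3) C(3) by simp
    finally show False using Y(3) by simp
  qed
  ultimately have coord0: "X = {0}" by blast
  show ?thesis
  proof
    fix v assume v: "v \<in> Y"
    then obtain x y where xy: "v = x + y" "x \<in> A" "y \<in> W" using YE by blast
    then have "x \<in> X" unfolding X_def using v by blast
    then show "v \<in> W" using coord0 xy by simp
  qed
qed

text \<open>Comparing leading coefficients in f h' = h f' shows that a nonzero solution h has the
  degree of f. Subtracting from g the multiple of f with the same leading coefficient gives a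
  solution whose coefficient in that degree is 0, hence the zero solution.\<close>

lemma wronskian_zero:
  fixes f g :: "complex poly"
  assumes "f \<noteq> 0" "f * pderiv g = g * pderiv f"
  shows "\<exists>c. g = smult c f"
proof -
  have deg: "degree h = degree f" if h: "h \<noteq> 0" "f * pderiv h = h * pderiv f" for h
  proof (cases "degree h = 0 \<or> degree f = 0")
    case True
    then have "pderiv h = 0 \<or> pderiv f = 0" by (simp add: pderiv_eq_0_iff)
    then have "pderiv h = 0 \<and> pderiv f = 0" using h assms(1) by auto
    then show ?thesis by (simp add: pderiv_eq_0_iff)
  next
    case False
    have lc: "lead_coeff (pderiv p) = of_nat (degree p) * lead_coeff p" if "degree p \<noteq> 0" for p :: "complex poly"
      using that by (simp add: degree_pderiv coeff_pderiv)
    have "lead_coeff (f * pderiv h) = lead_coeff (h * pderiv f)" using h(2) by simp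
    then have "lead_coeff f * (of_nat (degree h) * lead_coeff h) = lead_coeff h * (of_nat (degree f) * lead_coeff f)"
      using False by (simp only: lead_coeff_mult lc[of h] lc[of f] de_Morgan_disj not_False_eq_True)
    then show ?thesis using h(1) assms(1) by simp
  qed
  show ?thesis
  proof (cases "g = 0")
    case True
    then show ?thesis by (intro exI[of _ 0]) simp
  next
    case False
    define c where "c = lead_coeff g / lead_coeff f"
    define h where "h = g - smult c f"
    have "f * pderiv h = h * pderiv f"
      using assms(2) by (simp add: h_def pderiv_diff pderiv_smult algebra_simps)
    moreover have "coeff h (degree f) = 0"
      using deg[OF False assms(2)] assms(1) by (simp add: h_def c_def)
    ultimately have "h = 0" using deg[of h] by (metis leading_coeff_0_iff)
    then show ?thesis unfolding h_def by auto
  qed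
qed

section \<open>Counting dimensions\<close>

lemma sum_dims:
  assumes "2 * k \<le> n - 1" "1 \<le> n"
  shows "int (\<Sum>j\<le>k. 2 * (n - 1 - 2 * j) + 1) = (int k + 1) * (2 * int n - 1 - 2 * int k)"
  using assms
proof (induction k)
  case 0
  then show ?case by (cases n) simp_all
next
  case (Suc k)
  \<comment> \<open>The bound \<open>2 * Suc k \<le> n - 1\<close> makes the truncated subtraction
    exact.\<close>
  then have "int (2 * (n - 1 - 2 * Suc k) + 1) = 2 * (int n - 1 - 2 * (int k + 1)) + 1"
    by (simp add: of_nat_diff)
  moreover have "int (\<Sum>j\<le>k. 2 * (n - 1 - 2 * j) + 1) = (int k + 1) * (2 * int n - 1 - 2 * int k)"
    using Suc by simp
  ultimately show ?case
    unfolding sum.atMost_Suc of_nat_add[of "sum _ _"] by (simp add: algebra_simps)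
qed

lemma sum_dims_total:
  fixes n :: nat
  assumes "1 \<le> n"
  shows "(\<Sum>j | 2 * j \<le> n - 1. 2 * (n - 1 - 2 * j) + 1) = n * (n + 1) div 2"
proof -
  define k where "k = (n - 1) div 2"
  have J: "{j. 2 * j \<le> n - 1} = {..k}" by (auto simp: k_def)
  have "int (\<Sum>j\<le>k. 2 * (n - 1 - 2 * j) + 1) = (int k + 1) * (2 * int n - 1 - 2 * int k)"
    using assms by (intro sum_dims) (auto simp: k_def)
  \<comment> \<open>The last summand is S^0 U for odd n and S^2 U for even n; the total is n(n+1)/2
    in both cases.\<close>
  moreover have "n = 2 * k + 1 \<or> n = 2 * k + 2" using assms by (auto simp: k_def)
  then have "2 * ((int k + 1) * (2 * int n - 1 - 2 * int k)) = int (n * (n + 1))"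
    by (auto simp: algebra_simps)
  moreover define S where "S = (\<Sum>j\<le>k. 2 * (n - 1 - 2 * j) + 1)"
  ultimately have "2 * int S = int (n * (n + 1))" by simp
  then have "int (2 * S) = int (n * (n + 1))" by (simp only: of_nat_mult of_nat_numeral)
  then have "2 * S = n * (n + 1)" by (rule of_nat_eq_iff[THEN iffD1])
  then show ?thesis unfolding J S_def by simp
qed

section \<open>Sums of subrepresentations\<close>

lemma eval_pair_sum: "eval_pair (\<Sum>i\<in>I. F i) p = (\<Sum>i\<in>I. eval_pair (F i) p)"
proof (induction I rule: infinite_finite_induct)
  case (infinite I)
  show ?case unfolding sum.infinite[OF infinite] eval_pair_zero by (rule zero_fun_apply)
next
  case empty
  show ?case unfolding sum.empty eval_pair_zero by (rule zero_fun_apply)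
next
  case (insert i I)
  then show ?case unfolding sum.insert[OF insert(1,2)] eval_pair_add by simp
qed

lemma sum_subspaces_subrep:
  assumes s: "vector_space s" and lin: "\<And>g. g \<in> G \<Longrightarrow> Vector_Spaces.linear s s (\<rho> g)"
    and V: "\<And>i. i \<in> I \<Longrightarrow> subrep s G \<rho> (V i)"
  shows "subrep s G \<rho> (sum_subspaces I V)"
proof -
  interpret s: vector_space s by (rule s)
  have sub: "s.subspace (V i)" and stab: "\<And>g x. g \<in> G \<Longrightarrow> x \<in> V i \<Longrightarrow> \<rho> g x \<in> V i" if "i \<in> I" for i
    using V[OF that] unfolding subrep_def by auto
  have "s.subspace (sum_subspaces I V)"
  proof (rule s.subspaceI)
    show "0 \<in> sum_subspaces I V"
      unfolding sum_subspaces_def using sub s.subspace_0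
      by (auto intro!: exI[of _ "\<lambda>i. 0"])
    show "x + y \<in> sum_subspaces I V" if xy: "x \<in> sum_subspaces I V" "y \<in> sum_subspaces I V" for x y
    proof -
      obtain a b where ab: "x = (\<Sum>i\<in>I. a i)" "\<forall>i\<in>I. a i \<in> V i" "y = (\<Sum>i\<in>I. b i)" "\<forall>i\<in>I. b i \<in> V i"
        using xy unfolding sum_subspaces_def by blast
      have "x + y = (\<Sum>i\<in>I. a i + b i)" using ab by (simp add: sum.distrib)
      moreover have "\<forall>i\<in>I. a i + b i \<in> V i" using ab sub s.subspace_add by blast
      ultimately show ?thesis unfolding sum_subspaces_def by blast
    qed
    show "s c x \<in> sum_subspaces I V" if x: "x \<in> sum_subspaces I V" for c x
    proof -
      obtain a where a: "x = (\<Sum>i\<in>I. a i)" "\<forall>i\<in>I. a i \<in> V i"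
        using x unfolding sum_subspaces_def by blast
      have "s c x = (\<Sum>i\<in>I. s c (a i))" using a by (simp add: s.scale_sum_right)
      moreover have "\<forall>i\<in>I. s c (a i) \<in> V i" using a sub s.subspace_scale by blast
      ultimately show ?thesis unfolding sum_subspaces_def by blast
    qed
  qed
  moreover have "\<rho> g x \<in> sum_subspaces I V" if gx: "g \<in> G" "x \<in> sum_subspaces I V" for g x
  proof -
    interpret g: Vector_Spaces.linear s s "\<rho> g" by (rule lin[OF gx(1)])
    obtain a where a: "x = (\<Sum>i\<in>I. a i)" "\<forall>i\<in>I. a i \<in> V i"
      using gx(2) unfolding sum_subspaces_def by blast
    have "\<rho> g x = (\<Sum>i\<in>I. \<rho> g (a i))" using a by (simp add: g.sum)
    moreover have "\<forall>i\<in>I. \<rho> g (a i) \<in> V i" using a stab gx(1) by blast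
    ultimately show ?thesis unfolding sum_subspaces_def by blast
  qed
  ultimately show ?thesis unfolding subrep_def by blast
qed

lemma sum_subspaces_least:
  assumes "vector_space s" "module.subspace s W" "\<And>i. i \<in> I \<Longrightarrow> V i \<subseteq> W"
  shows "sum_subspaces I V \<subseteq> W"
proof -
  interpret vector_space s by (rule assms(1))
  show ?thesis
    unfolding sum_subspaces_def using assms(3) by (auto intro!: subspace_sum[OF assms(2)])
qed

lemma sum_subspaces_remove:
  assumes "finite I" "k \<in> I"
  shows "sum_subspaces I V \<subseteq> {x + y |x y. x \<in> V k \<and> y \<in> sum_subspaces (I - {k}) V}"
proof
  fix z assume "z \<in> sum_subspaces I V"
  then obtain x where x: "z = (\<Sum>i\<in>I. x i)" "\<forall>i\<in>I. x i \<in> V i"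
    unfolding sum_subspaces_def by blast
  have "z = x k + (\<Sum>i\<in>I - {k}. x i)" using x(1) sum.remove[OF assms] by simp
  moreover have "(\<Sum>i\<in>I - {k}. x i) \<in> sum_subspaces (I - {k}) V"
    unfolding sum_subspaces_def using x(2) by auto
  ultimately show "z \<in> {x + y |x y. x \<in> V k \<and> y \<in> sum_subspaces (I - {k}) V}"
    using x(2) assms(2) by blast
qed

text \<open>Placing \<open>y\<close> in slot \<open>k\<close> gives a relation over all of
  \<open>I\<close>. The case y = 0 is independence of the remaining summands; the general case is
  that \<open>V k\<close> meets their sum trivially.\<close>

lemma internal_direct_sum_remove:
  assumes "internal_direct_sum E I V" "k \<in> I" "0 \<in> V k"
    and "\<forall>i\<in>I - {k}. x i \<in> V i" "(\<Sum>i\<in>I - {k}. x i) = - y" "y \<in> V k"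
  shows "y = 0" "\<forall>i\<in>I - {k}. x i = 0"
proof -
  have fin: "finite I" using assms(1) by (simp add: internal_direct_sum_def)
  let ?x = "x(k := y)"
  have "(\<Sum>i\<in>I - {k}. ?x i) = (\<Sum>i\<in>I - {k}. x i)" by (rule sum.cong) auto
  then have "(\<Sum>i\<in>I. ?x i) = 0" using sum.remove[OF fin assms(2), of ?x] assms(5) by simp
  moreover have "\<forall>i\<in>I. ?x i \<in> V i" using assms(4,6) by auto
  moreover have "(\<forall>i\<in>I. ?x i \<in> V i) \<and> (\<Sum>i\<in>I. ?x i) = 0 \<longrightarrow> (\<forall>i\<in>I. ?x i = 0)"
    using assms(1) unfolding internal_direct_sum_def by (elim conjE) (erule spec)
  ultimately have "\<forall>i\<in>I. ?x i = 0" by blast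
  then have x0: "?x i = 0" if "i \<in> I" for i using that by blast
  show "y = 0" using x0[OF assms(2)] by simp
  show "\<forall>i\<in>I - {k}. x i = 0"
  proof
    fix i assume "i \<in> I - {k}"
    then show "x i = 0" using x0[of i] by simp
  qed
qed

section \<open>Independence and completeness of the embedded summands\<close>

context plane
begin

lemma embed_0: "embed j m 0 = 0"
  using embed_linear(2)[OF fs.subspace_0[OF sym_power_subspace] fs.subspace_0[OF sym_power_subspace], of j m 0]
  by (simp only: fs.scale_zero_left)

lemma embed_independent:
  assumes "finite J" "\<And>j. j \<in> J \<Longrightarrow> h j \<in> sym_power s (2 * m j)"
    and zero: "(\<Sum>j\<in>J. embed j (m j) (h j)) = 0"
  shows "j \<in> J \<Longrightarrow> h j = 0"
proof (induction j rule: less_induct)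
  case (less j)
  have "h j (covec 1 z) = 0" for z
  proof -
    have "\<forall>i\<in>J. \<exists>q. (\<forall>w. eval_pair (embed i (m i) (h i)) (covec 1 z, covec 1 w) = (w - z) ^ (2 * i + 1) * poly q w) \<and>
        poly q z = of_nat ((2 * m i) choose (m i)) * h i (covec 1 z)"
      using embed_poly[OF assms(2)] by metis
    then obtain q where q: "\<And>i w. i \<in> J \<Longrightarrow> eval_pair (embed i (m i) (h i)) (covec 1 z, covec 1 w) = (w - z) ^ (2 * i + 1) * poly (q i) w"
      "\<And>i. i \<in> J \<Longrightarrow> poly (q i) z = of_nat ((2 * m i) choose (m i)) * h i (covec 1 z)"
      by metis
    \<comment> \<open>Terms of index below \<open>j\<close> vanish by the induction hypothesis, so
      (w - z)^(2j+1) divides all that remain.\<close>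
    define J' where "J' = {i \<in> J. j \<le> i}"
    have J': "finite J'" "J' \<subseteq> J" using assms(1) by (auto simp: J'_def)
    have "(\<Sum>i\<in>J. embed i (m i) (h i)) = (\<Sum>i\<in>J'. embed i (m i) (h i))"
    proof (rule sum.mono_neutral_right[OF assms(1) J'(2)], rule ballI)
      fix i assume "i \<in> J - J'"
      then have "i < j" "i \<in> J" by (auto simp: J'_def)
      then have "h i = 0" by (rule less.IH)
      then show "embed i (m i) (h i) = 0" by (simp only: embed_0)
    qed
    then have zero': "(\<Sum>i\<in>J'. embed i (m i) (h i)) = 0" using zero by simp
    \<comment> \<open>The relation divided by (w - z)^(2j+1). Terms with i > j retain a positive
      power of w - z, so at w = z only index \<open>j\<close> survives.\<close>
    define R where "R = (\<Sum>i\<in>J'. [:-z, 1:] ^ (2 * (i - j)) * q i)"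
    have "poly ([:-z, 1:] ^ (2 * j + 1) * R) w = 0" for w
    proof -
      have "poly ([:-z, 1:] ^ (2 * j + 1) * R) w = (\<Sum>i\<in>J'. (w - z) ^ (2 * j + 1) * ((w - z) ^ (2 * (i - j)) * poly (q i) w))"
        by (simp only: R_def poly_mult poly_power poly_sum sum_distrib_left) (simp add: algebra_simps)
      also have "\<dots> = (\<Sum>i\<in>J'. eval_pair (embed i (m i) (h i)) (covec 1 z, covec 1 w))"
      proof (rule sum.cong[OF refl])
        fix i assume i: "i \<in> J'"
        then have "2 * i + 1 = (2 * j + 1) + 2 * (i - j)" by (auto simp: J'_def)
        then have "(w - z) ^ (2 * i + 1) = (w - z) ^ (2 * j + 1) * (w - z) ^ (2 * (i - j))"
          by (simp only: power_add)
        moreover have "i \<in> J" using i J' by blast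
        ultimately show "(w - z) ^ (2 * j + 1) * ((w - z) ^ (2 * (i - j)) * poly (q i) w) =
            eval_pair (embed i (m i) (h i)) (covec 1 z, covec 1 w)"
          by (simp only: q(1) mult.assoc)
      qed
      also have "\<dots> = 0"
        unfolding eval_pair_sum[symmetric] zero' eval_pair_zero by simp
      finally show ?thesis .
    qed
    then have "[:-z, 1:] ^ (2 * j + 1) * R = 0"
      using poly_all_0_iff_0 by blast
    moreover have "[:-z, 1:] ^ (2 * j + 1) \<noteq> 0" by (rule power_not_zero) simp
    ultimately have "R = 0" by (simp only: mult_eq_0_iff simp_thms)
    then have "0 = poly R z" by simp
    also have "\<dots> = (\<Sum>i\<in>J'. if i = j then poly (q i) z else 0)"
      unfolding R_def poly_sum by (rule sum.cong) (auto simp: J'_def)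
    also have "\<dots> = poly (q j) z"
      using J' less.prems by (simp add: J'_def)
    finally show ?thesis using q(2)[OF less.prems] by simp
  qed
  then show ?case by (rule sym_power_eq_0[OF assms(2)[OF less.prems]])
qed

definition summand :: "nat \<Rightarrow> nat \<Rightarrow> (((('u \<Rightarrow> complex) \<Rightarrow> complex) \<Rightarrow> complex) \<times> ((('u \<Rightarrow> complex) \<Rightarrow> complex) \<Rightarrow> complex) \<Rightarrow> complex) set" where
  "summand n j = embed j (n - 1 - 2 * j) ` sym_power s (2 * (n - 1 - 2 * j))"

abbreviation "act \<equiv> \<lambda>g. ext_map fscale (sym_map s g)"

lemma summand_iso:
  "rep_iso (SL s) fscale (sym_map s) (sym_power s (2 * (n - 1 - 2 * j))) fscale act (summand n j)"
  unfolding rep_iso_def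
proof (intro exI[of _ "embed j (n - 1 - 2 * j)"] conjI ballI allI)
  let ?m = "n - 1 - 2 * j"
  show "bij_betw (embed j ?m) (sym_power s (2 * ?m)) (summand n j)"
    unfolding bij_betw_def summand_def
  proof (intro conjI refl inj_onI)
    fix x y assume xy: "x \<in> sym_power s (2 * ?m)" "y \<in> sym_power s (2 * ?m)" "embed j ?m x = embed j ?m y"
    \<comment> \<open>Injectivity is independence for a single index, applied to the
      difference.\<close>
    let ?d = "x + fscale (- 1) y"
    have y: "fscale (- 1) y \<in> sym_power s (2 * ?m)"
      by (intro fs.subspace_scale sym_power_subspace xy)
    have d: "?d \<in> sym_power s (2 * ?m)"
      by (intro fs.subspace_add sym_power_subspace xy y)
    have "embed j ?m ?d = embed j ?m x + fscale (- 1) (embed j ?m y)"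
      unfolding embed_linear(1)[OF xy(1) y] embed_linear(2)[OF xy(2) xy(2)] ..
    also have "\<dots> = 0" using xy(3) by (simp add: fun_eq_iff)
    finally have "(\<Sum>i\<in>{j}. embed i ?m ?d) = 0" by simp
    then have "?d = 0"
      using embed_independent[of "{j}" "\<lambda>_. ?d" "\<lambda>_. ?m" j] d by simp
    then show "x = y" by (simp add: fun_eq_iff)
  qed
next
  fix x y assume "x \<in> sym_power s (2 * (n - 1 - 2 * j))" "y \<in> sym_power s (2 * (n - 1 - 2 * j))"
  then show "embed j (n - 1 - 2 * j) (x + y) = embed j (n - 1 - 2 * j) x + embed j (n - 1 - 2 * j) y"
    by (rule embed_linear(1))
next
  fix c x assume "x \<in> sym_power s (2 * (n - 1 - 2 * j))"
  then show "embed j (n - 1 - 2 * j) (fscale c x) = fscale c (embed j (n - 1 - 2 * j) x)"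
    using embed_linear(2) by metis
next
  fix g x assume "g \<in> SL s" "x \<in> sym_power s (2 * (n - 1 - 2 * j))"
  then show "embed j (n - 1 - 2 * j) (sym_map s g x) = act g (embed j (n - 1 - 2 * j) x)"
    by (rule embed_equivariant)
qed

lemma summand_irreducible: "irreducible_rep fscale (SL s) act (summand n j)"
  by (rule rep_iso_irreducible[OF summand_iso vector_space_fscale vector_space_fscale sym_power_irreducible])

lemma summand_iso_sym: "rep_iso (SL s) fscale act (summand n j) fscale (sym_map s) (sym_power s (2 * (n - 1 - 2 * j)))"
  by (rule rep_iso_sym[OF summand_iso vector_space_fscale subrep_sym_power])

lemma summand_has_dim: "fs.has_dim (summand n j) (2 * (n - 1 - 2 * j) + 1)"
  by (rule rep_iso_has_dim[OF summand_iso vector_space_fscale vector_space_fscale sym_power_has_dim])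

lemma summand_subset:
  assumes "2 * j \<le> n - 1" "1 \<le> n"
  shows "summand n j \<subseteq> ext_square fscale (sym_power s n)"
proof -
  have "n - 1 - 2 * j + (2 * j + 1) = n" using assms by simp
  then have "embed j (n - 1 - 2 * j) h \<in> ext_square fscale (sym_power s n)"
    if "h \<in> sym_power s (2 * (n - 1 - 2 * j))" for h
    using embed(1)[OF that, of j] by simp
  then show ?thesis unfolding summand_def by (rule image_subsetI)
qed

lemma summand_direct_sum:
  assumes "1 \<le> n"
  shows "internal_direct_sum (ext_square fscale (sym_power s n)) {j. 2 * j \<le> n - 1} (summand n)"
proof -
  let ?J = "{j. 2 * j \<le> n - 1}"
  let ?E = "ext_square fscale (sym_power s n)"
  have fin: "finite ?J" by (rule finite_subset[of _ "{..n}"]) auto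
  have indep: "\<forall>j\<in>?J. x j = 0" if x: "\<forall>j\<in>?J. x j \<in> summand n j" "(\<Sum>j\<in>?J. x j) = 0" for x
  proof -
    have "\<forall>j\<in>?J. \<exists>h\<in>sym_power s (2 * (n - 1 - 2 * j)). x j = embed j (n - 1 - 2 * j) h"
      using x(1) unfolding summand_def by blast
    then obtain h where h: "\<And>j. j \<in> ?J \<Longrightarrow> h j \<in> sym_power s (2 * (n - 1 - 2 * j))"
      "\<And>j. j \<in> ?J \<Longrightarrow> x j = embed j (n - 1 - 2 * j) (h j)"
      by metis
    have zero: "(\<Sum>j\<in>?J. embed j (n - 1 - 2 * j) (h j)) = 0"
      using x(2) h(2) by simp
    have "x j = 0" if j: "j \<in> ?J" for j
    proof -
      have "h j = 0"
        by (rule embed_independent[of ?J h "\<lambda>j. n - 1 - 2 * j" j, OF fin h(1) zero j])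
      then show ?thesis unfolding h(2)[OF j] by (simp only: embed_0)
    qed
    then show ?thesis by blast
  qed
  have "fs.has_dim (sum_subspaces ?J (summand n)) (\<Sum>j\<in>?J. 2 * (n - 1 - 2 * j) + 1)"
    by (rule fs.has_dim_sum_subspaces[OF fin summand_has_dim indep])
  then have dim: "fs.has_dim (sum_subspaces ?J (summand n)) (n * (n + 1) div 2)"
    unfolding sum_dims_total[OF assms] .
  have le: "sum_subspaces ?J (summand n) \<subseteq> ?E"
    by (rule sum_subspaces_least[OF vector_space_fscale ext_square_subspace])
      (use summand_subset assms in auto)
  obtain S where S: "finite S" "card S \<le> n * (n + 1) div 2" "?E \<subseteq> fs.span S"
    by (rule ext_square_le, rule that)
  have "sum_subspaces ?J (summand n) = ?E"
    by (rule fs.subspace_eqI_has_dim[OF dim le S(3,1,2)])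
  then show ?thesis
    unfolding internal_direct_sum_def using fin
  proof (intro conjI allI impI)
    fix x assume "(\<forall>j\<in>?J. x j \<in> summand n j) \<and> (\<Sum>j\<in>?J. x j) = 0"
    then show "\<forall>j\<in>?J. x j = 0" by (elim conjE) (rule indep)
  qed simp_all
qed

section \<open>Decomposable bivectors and vanishing on the diagonal\<close>

lemma wedge_eq_0_if_vanishing:
  assumes v: "v \<in> sym_power s n" "v' \<in> sym_power s n"
    and van: "\<And>z. \<exists>q. \<forall>w. eval_pair (wedge fscale v v') (covec 1 z, covec 1 w) = (w - z) ^ 2 * poly q w"
  shows "wedge fscale v v' = 0"
proof -
  obtain f where f: "v = homog n f" "\<And>z. v (covec 1 z) = poly f z"
    by (rule sym_power_poly[OF v(1)], rule that)
  obtain g where g: "v' = homog n g" "\<And>z. v' (covec 1 z) = poly g z"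
    by (rule sym_power_poly[OF v(2)], rule that)
  \<comment> \<open>For fixed z the bivector evaluates to f(z) g(w) - g(z) f(w). A double zero at w
    = z kills its derivative in w there, which is the Wronskian of f and g at z.\<close>
  have "poly f z * poly (pderiv g) z = poly g z * poly (pderiv f) z" for z
  proof -
    obtain q where q: "\<And>w. eval_pair (wedge fscale v v') (covec 1 z, covec 1 w) = (w - z) ^ 2 * poly q w"
      using van by blast
    have "poly (smult (poly f z) g - smult (poly g z) f) w = poly ([:-z, 1:] ^ 2 * q) w" for w
      using q[of w] unfolding eval_pair_wedge f(2) g(2) by (simp add: algebra_simps)
    then have "smult (poly f z) g - smult (poly g z) f = [:-z, 1:] ^ 2 * q"
      by (simp add: poly_eq_poly_eq_iff[symmetric] fun_eq_iff)
    then have "poly (pderiv (smult (poly f z) g - smult (poly g z) f)) z = poly (pderiv ([:-z, 1:] ^ 2 * q)) z"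
      by simp
    also have "\<dots> = 0"
    proof -
      define l where "l = [:-z, 1:]"
      have "poly l z = 0" by (simp add: l_def)
      then show ?thesis unfolding l_def[symmetric] by (simp add: pderiv_mult power2_eq_square)
    qed
    finally show ?thesis by (simp add: pderiv_diff pderiv_smult)
  qed
  then have W: "f * pderiv g = g * pderiv f"
    by (simp add: poly_eq_poly_eq_iff[symmetric] fun_eq_iff)
  show ?thesis
  proof (cases "f = 0")
    case True
    then have "v = 0" using f(1) homog_0 by simp
    then show ?thesis using wedge_0_left[OF vector_space_fscale] by simp
  next
    case False
    then obtain c where "g = smult c f" using wronskian_zero W by blast
    then have "v' = fscale c v" using f(1) g(1) homog_smult by simp
    show ?thesis
      unfolding \<open>v' = fscale c v\<close> by (auto simp: wedge_def fun_eq_iff dual_scale simp del: fscale_apply)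
  qed
qed

text \<open>For j \<ge> 1 the exponent splits as 2j + 1 = 2 + (2j - 1), which yields the double zero
  that the Wronskian argument consumes.\<close>

lemma summands_vanishing:
  assumes "finite I" "0 \<notin> I" "F \<in> sum_subspaces I (summand n)"
  shows "\<exists>q. \<forall>w. eval_pair F (covec 1 z, covec 1 w) = (w - z) ^ 2 * poly q w"
proof -
  obtain x where x: "F = (\<Sum>j\<in>I. x j)" "\<forall>j\<in>I. x j \<in> summand n j"
    using assms(3) unfolding sum_subspaces_def by blast
  have "\<exists>q. \<forall>w. eval_pair (x j) (covec 1 z, covec 1 w) = (w - z) ^ 2 * poly q w" if j: "j \<in> I" for j
  proof -
    obtain h where h: "h \<in> sym_power s (2 * (n - 1 - 2 * j))" "x j = embed j (n - 1 - 2 * j) h"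
      using x(2) j unfolding summand_def by blast
    obtain q where q: "\<And>w. eval_pair (x j) (covec 1 z, covec 1 w) = (w - z) ^ (2 * j + 1) * poly q w"
      by (rule embed_poly[OF h(1), where j = j and z = z, folded h(2)], rule that)
    have "j \<noteq> 0" using j assms(2) by metis
    then have "2 * j + 1 = 2 + (2 * j - 1)" by simp
    then have "(w - z) ^ (2 * j + 1) = (w - z) ^ 2 * (w - z) ^ (2 * j - 1)" for w
      by (simp only: power_add)
    then show ?thesis
      unfolding q by (intro exI[of _ "[:-z, 1:] ^ (2 * j - 1) * q"]) simp
  qed
  then obtain q where q: "\<And>j w. j \<in> I \<Longrightarrow> eval_pair (x j) (covec 1 z, covec 1 w) = (w - z) ^ 2 * poly (q j) w"
    by metis
  have "eval_pair F (covec 1 z, covec 1 w) = (w - z) ^ 2 * poly (\<Sum>j\<in>I. q j) w" for w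
    unfolding x(1) eval_pair_sum poly_sum sum_distrib_left by (rule sum.cong) (simp_all add: q)
  then show ?thesis by blast
qed

section \<open>The complement of the top summand in an arbitrary decomposition\<close>

lemma summand_decomposition:
  assumes "1 \<le> n"
  shows "irreducible_decomposition fscale (SL s) act (ext_square fscale (sym_power s n)) {j. 2 * j \<le> n - 1} (summand n)"
  unfolding irreducible_decomposition_def
  by (intro conjI ballI summand_direct_sum summand_irreducible assms)

text \<open>Formulated for any family with the right dimensions, since it applies both to the
  embedded copies and to an arbitrary decomposition. The number 2n - 1 is the dimension of the top
  summand; the doubled equation avoids a division.\<close>

lemma complement_of_first_summand:
  assumes n: "1 \<le> n" and V: "internal_direct_sum E {j. 2 * j \<le> n - 1} V"
    and dim: "\<And>j. 2 * j \<le> n - 1 \<Longrightarrow> fs.has_dim (V j) (2 * (n - 1 - 2 * j) + 1)"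
  shows "\<exists>d. fs.has_dim (sum_subspaces ({j. 2 * j \<le> n - 1} - {0}) V) d \<and> 2 * d + 2 * (2 * n - 1) = n * (n + 1)"
    and "V 0 \<inter> sum_subspaces ({j. 2 * j \<le> n - 1} - {0}) V \<subseteq> {0}"
proof -
  let ?J = "{j. 2 * j \<le> n - 1}"
  have fin: "finite ?J" using V by (simp add: internal_direct_sum_def)
  have 0: "0 \<in> ?J" by simp
  have sub: "fs.subspace (V 0)" using dim[of 0] fs.has_dim_imp_subspace by simp
  note remove = internal_direct_sum_remove[OF V 0 fs.subspace_0[OF sub]]
  define d where "d = (\<Sum>j\<in>?J - {0}. 2 * (n - 1 - 2 * j) + 1)"
  have "fs.has_dim (sum_subspaces (?J - {0}) V) d"
    unfolding d_def
  proof (rule fs.has_dim_sum_subspaces)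
    fix x assume x: "\<forall>j\<in>?J - {0}. x j \<in> V j" "(\<Sum>j\<in>?J - {0}. x j) = 0"
    have "(\<Sum>j\<in>?J - {0}. x j) = - 0" unfolding x(2) by (rule minus_zero[symmetric])
    then show "\<forall>j\<in>?J - {0}. x j = 0"
      by (rule remove(2)[OF x(1) _ fs.subspace_0[OF sub]])
  qed (use fin dim in auto)
  moreover have "2 * d + 2 * (2 * n - 1) = n * (n + 1)"
  proof -
    have "(\<Sum>j\<in>?J. 2 * (n - 1 - 2 * j) + 1) = 2 * (n - 1 - 2 * 0) + 1 + d"
      unfolding d_def by (rule sum.remove[OF fin 0])
    then have "n * (n + 1) div 2 = 2 * n - 1 + d"
      unfolding sum_dims_total[OF n] using n by simp
    moreover have "2 * (n * (n + 1) div 2) = n * (n + 1)" by simp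
    ultimately show ?thesis by simp
  qed
  ultimately show "\<exists>d. fs.has_dim (sum_subspaces (?J - {0}) V) d \<and> 2 * d + 2 * (2 * n - 1) = n * (n + 1)"
    by blast
  show "V 0 \<inter> sum_subspaces (?J - {0}) V \<subseteq> {0}"
  proof
    fix y assume y: "y \<in> V 0 \<inter> sum_subspaces (?J - {0}) V"
    then obtain x where x: "y = (\<Sum>j\<in>?J - {0}. x j)" "\<forall>j\<in>?J - {0}. x j \<in> V j"
      unfolding sum_subspaces_def by blast
    have "(\<Sum>j\<in>?J - {0}. x j) = - (- y)" unfolding x(1) by (rule minus_minus[symmetric])
    moreover have "- y \<in> V 0" using y fs.subspace_neg[OF sub] by blast
    ultimately have "- y = 0" by (rule remove(1)[OF x(2)])
    then show "y \<in> {0}" by (simp only: neg_equal_0_iff_equal singleton_iff)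
  qed
qed

text \<open>Transfers the vanishing on the diagonal from the embedded copies to an arbitrary
  decomposition.\<close>

lemma complement_subset_summands:
  assumes n: "1 \<le> n"
    and V: "irreducible_decomposition fscale (SL s) act (ext_square fscale (sym_power s n)) {j. 2 * j \<le> n - 1} V"
    and dim: "\<And>j. 2 * j \<le> n - 1 \<Longrightarrow> fs.has_dim (V j) (2 * (n - 1 - 2 * j) + 1)"
  shows "sum_subspaces ({j. 2 * j \<le> n - 1} - {0}) V \<subseteq> sum_subspaces ({j. 2 * j \<le> n - 1} - {0}) (summand n)"
proof -
  let ?J = "{j. 2 * j \<le> n - 1}"
  let ?E = "ext_square fscale (sym_power s n)"
  let ?W = "sum_subspaces (?J - {0}) (summand n)"
  have lin: "Vector_Spaces.linear fscale fscale (act g)" for g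
    by (rule linear_ext_map)
  have W: "subrep fscale (SL s) act ?W"
    by (rule sum_subspaces_subrep[OF vector_space_fscale lin])
      (use summand_irreducible in \<open>auto simp: irreducible_rep_def\<close>)
  obtain d where "fs.has_dim ?W d \<and> 2 * d + 2 * (2 * n - 1) = n * (n + 1)"
    using complement_of_first_summand(1)[OF n summand_direct_sum[OF n] summand_has_dim] by (rule exE)
  then have d: "fs.has_dim ?W d" by (rule conjunct1)
  have fin: "finite ?J"
    using summand_direct_sum[OF n] unfolding internal_direct_sum_def by (rule conjunct1)
  have E: "?E = sum_subspaces ?J (summand n)"
    using summand_direct_sum[OF n] unfolding internal_direct_sum_def by (elim conjE)
  have EV: "?E = sum_subspaces ?J V"
    using V unfolding internal_direct_sum_def irreducible_decomposition_def by (elim conjE)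
  have VE: "V j \<subseteq> ?E" if j: "j \<in> ?J" for j
  proof
    fix v assume v: "v \<in> V j"
    let ?x = "\<lambda>i. if i = j then v else 0"
    have "fs.subspace (V i)" if "i \<in> ?J" for i
      by (rule fs.has_dim_imp_subspace[OF dim]) (use that in simp)
    then have "?x i \<in> V i" if "i \<in> ?J" for i
      using v fs.subspace_0[of "V i"] that by (cases "i = j") (simp_all only: if_True if_False simp_thms)
    then have "\<forall>i\<in>?J. ?x i \<in> V i" by (rule ballI)
    moreover have "v = (\<Sum>i\<in>?J. ?x i)" using fin j by simp
    ultimately show "v \<in> ?E"
      unfolding EV sum_subspaces_def by (intro CollectI exI[of _ ?x] conjI)
  qed
  have "V j \<subseteq> ?W" if j: "j \<in> ?J - {0}" for j
  proof (rule subrep_subset_complement[OF vector_space_fscale lin])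
    show "irreducible_rep fscale (SL s) act (summand n 0)" by (rule summand_irreducible)
    show "fs.has_dim (summand n 0) (2 * (n - 1 - 2 * 0) + 1)" by (rule summand_has_dim)
    show "subrep fscale (SL s) act ?W" "fs.has_dim ?W d" by (rule W, rule d)
    show "summand n 0 \<inter> ?W \<subseteq> {0}"
      by (rule complement_of_first_summand(2)[OF n summand_direct_sum[OF n] summand_has_dim])
    show "subrep fscale (SL s) act (V j)"
    proof -
      have "\<forall>i\<in>?J. irreducible_rep fscale (SL s) act (V i)"
        using V unfolding irreducible_decomposition_def by (rule conjunct2)
      moreover have "j \<in> ?J" using j by (rule DiffD1)
      ultimately have "irreducible_rep fscale (SL s) act (V j)" by (rule bspec)
      then show ?thesis unfolding irreducible_rep_def by (rule conjunct1)
    qed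
    show "fs.has_dim (V j) (2 * (n - 1 - 2 * j) + 1)" by (rule dim) (use j in simp)
    \<comment> \<open>Strict because j > 0 and \<open>2 * j \<le> n - 1\<close> force n - 1 >
      0.\<close>
    show "2 * (n - 1 - 2 * j) + 1 < 2 * (n - 1 - 2 * 0) + 1" using j by auto
    have "V j \<subseteq> ?E" using VE j by blast
    also have "\<dots> \<subseteq> {x + y |x y. x \<in> summand n 0 \<and> y \<in> ?W}"
      unfolding E by (rule sum_subspaces_remove[OF fin]) simp
    finally show "V j \<subseteq> {x + y |x y. x \<in> summand n 0 \<and> y \<in> ?W}" .
  qed
  then show ?thesis
    by (rule sum_subspaces_least[OF vector_space_fscale W[unfolded subrep_def, THEN conjunct1]])
qed

end

theorem proposition2p1:
  fixes s :: "complex \<Rightarrow> 'u::ab_group_add \<Rightarrow> 'u" and n :: nat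
  assumes "vector_space s" and "vector_space.dim s (UNIV :: 'u set) = 2" and "1 \<le> n"
  shows "let G = SL s;
             SnU = sym_power s n;
             E = ext_square fscale SnU;
             act = (\<lambda>g. ext_map fscale (sym_map s g));
             J = {j :: nat. 2 * j \<le> n - 1};
             decomposition = (\<lambda>V.
               irreducible_decomposition fscale G act E J V \<and>
               (\<forall>j\<in>J. rep_iso G fscale act (V j)
                         fscale (sym_map s) (sym_power s (2 * (n - 1 - 2 * j)))))
         in (\<exists>V. decomposition V) \<and>
            (\<forall>V. decomposition V \<longrightarrow>
               (let W = sum_subspaces (J - {0}) V;
                    m = (real n - 2) * (real n - 1) / 2
                in real_of_int (proj_dim fscale W) = m - 1 \<and>
                   proj_space fscale W \<inter> grassmannian_lines fscale SnU = {} \<and>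
                   (\<forall>v\<in>SnU. \<forall>v'\<in>SnU. wedge fscale v v' \<in> W \<longrightarrow> wedge fscale v v' = 0)))"
proof -
  interpret vs: vector_space s by (rule assms(1))
  obtain u0 u1 where u: "u0 \<noteq> u1" "vs.independent {u0, u1}" "vs.span {u0, u1} = UNIV"
    using vs.exists_plane[OF assms(2)] by blast
  interpret plane s u0 u1
    by unfold_locales (fact u)+
  let ?S = "sym_power s n"
  let ?E = "ext_square fscale ?S"
  let ?act = "\<lambda>g. ext_map fscale (sym_map s g)"
  let ?J = "{j :: nat. 2 * j \<le> n - 1}"
  let ?D = "\<lambda>V. irreducible_decomposition fscale (SL s) ?act ?E ?J V \<and>
     (\<forall>j\<in>?J. rep_iso (SL s) fscale ?act (V j) fscale (sym_map s) (sym_power s (2 * (n - 1 - 2 * j))))"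
  have "?D (summand n)"
    using summand_decomposition[OF assms(3)] summand_iso_sym by blast
  moreover have "real_of_int (proj_dim fscale (sum_subspaces (?J - {0}) V)) = (real n - 2) * (real n - 1) / 2 - 1 \<and>
      proj_space fscale (sum_subspaces (?J - {0}) V) \<inter> grassmannian_lines fscale ?S = {} \<and>
      (\<forall>v\<in>?S. \<forall>v'\<in>?S. wedge fscale v v' \<in> sum_subspaces (?J - {0}) V \<longrightarrow> wedge fscale v v' = 0)"
    if D: "?D V" for V
  proof -
    let ?W = "sum_subspaces (?J - {0}) V"
    have dec: "irreducible_decomposition fscale (SL s) ?act ?E ?J V"
      and iso: "\<And>j. j \<in> ?J \<Longrightarrow> rep_iso (SL s) fscale ?act (V j) fscale (sym_map s) (sym_power s (2 * (n - 1 - 2 * j)))"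
      using D by blast+
    have ids: "internal_direct_sum ?E ?J V"
      and irr: "\<And>j. j \<in> ?J \<Longrightarrow> irreducible_rep fscale (SL s) ?act (V j)"
      using dec unfolding irreducible_decomposition_def by blast+
    have dim: "fs.has_dim (V j) (2 * (n - 1 - 2 * j) + 1)" if j: "2 * j \<le> n - 1" for j
    proof -
      have jJ: "j \<in> ?J" using j by simp
      have "subrep fscale (SL s) ?act (V j)"
        using irr[OF jJ] unfolding irreducible_rep_def by blast
      then have "rep_iso (SL s) fscale (sym_map s) (sym_power s (2 * (n - 1 - 2 * j))) fscale ?act (V j)"
        by (rule rep_iso_sym[OF iso[OF jJ] vector_space_fscale])
      then show ?thesis
        by (rule rep_iso_has_dim[OF _ vector_space_fscale vector_space_fscale sym_power_has_dim])
    qed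
    obtain d where d: "fs.has_dim ?W d" "2 * d + 2 * (2 * n - 1) = n * (n + 1)"
      using complement_of_first_summand(1)[OF assms(3) ids dim] by blast
    \<comment> \<open>Here 2d = n(n+1) - 2(2n-1) = (n-1)(n-2). For n \<le> 2 this means W = 0, with
      projective dimension -1.\<close>
    have "real (2 * d + 2 * (2 * n - 1)) = real (n * (n + 1))" by (simp only: d(2))
    then have "real d = (real n - 2) * (real n - 1) / 2"
      using assms(3) by (simp add: of_nat_diff algebra_simps)
    then have "real_of_int (proj_dim fscale ?W) = (real n - 2) * (real n - 1) / 2 - 1"
      unfolding proj_dim_def fs.has_dim_imp_dim[OF d(1)] by simp
    moreover have wedge0: "wedge fscale v v' = 0"
      if v: "v \<in> ?S" "v' \<in> ?S" "wedge fscale v v' \<in> ?W" for v v'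
    proof (rule wedge_eq_0_if_vanishing[OF v(1,2)])
      fix z
      have "wedge fscale v v' \<in> sum_subspaces (?J - {0}) (summand n)"
        using complement_subset_summands[OF assms(3) dec dim] v(3) by blast
      moreover have "finite (?J - {0})" using ids by (simp add: internal_direct_sum_def)
      ultimately show "\<exists>q. \<forall>w. eval_pair (wedge fscale v v') (covec 1 z, covec 1 w) = (w - z) ^ 2 * poly q w"
        by (intro summands_vanishing[of "?J - {0}"]) auto
    qed
    moreover have "proj_space fscale ?W \<inter> grassmannian_lines fscale ?S = {}"
    proof (rule equals0I)
      fix L assume "L \<in> proj_space fscale ?W \<inter> grassmannian_lines fscale ?S"
      then obtain w v v' where L: "L = fs.span {w}" "w \<in> ?W" "L = fs.span {wedge fscale v v'}"
        and v: "v \<in> ?S" "v' \<in> ?S" "wedge fscale v v' \<noteq> 0"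
        unfolding proj_space_def grassmannian_lines_def by blast
      \<comment> \<open>A common point is one line spanned both by a vector of \<open>?W\<close> and
        by a nonzero wedge, so the wedge lies in \<open>?W\<close>.\<close>
      have "fs.span {w} \<subseteq> ?W"
        using L(2) fs.has_dim_imp_subspace[OF d(1)] by (intro fs.span_minimal) auto
      moreover have "wedge fscale v v' \<in> fs.span {w}"
        unfolding L(1)[symmetric] L(3) by (rule fs.span_base) simp
      ultimately show False using wedge0 v by blast
    qed
    ultimately show ?thesis by blast
  qed
  ultimately show ?thesis
    unfolding Let_def by blast
qed

end
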